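(* Let $\mathcal{H}_1,\mathcal{H}_2$ be complex Hilbert spaces, let $S\in\mathcal{B}(\mathcal{H}_1)$, $T\in\mathcal{B}(\mathcal{H}_2)$, and let $\lambda\in[0,1]$. Then: (1) $M_\lambda(cS)=cM_\lambda(S)$ for every complex number $c$. (2) $M_\lambda(USU^* )=U M_\lambda(S)U^*$ for every unitary operator $U$ on $\mathcal{H}_1$. (3) $r_\sigma(M_\lambda(T\otimes S))=r_\sigma(M_\lambda(S\otimes T))$. (4) $r_\omega(M_\lambda(T\otimes S))=r_\omega(M_\lambda(S\otimes T))$. (5) $\|M_\lambda(T\otimes S)\|=\|M_\lambda(S\otimes T)\|$.
   Context: $\mathcal{B}(\mathcal{H})$ denotes the bounded linear operators on $\mathcal{H}$. For a bounded operator $T$, $|T|=(T^*T)^{1/2}$ and $T=V|T|$ is the canonical polar decomposition ($V$ a partial isometry with $\ker V=\ker T$). The Duggal transform is $T^D=|T|V$, and the $\lambda$-mean transform is $M_\lambda(T)=\lambda T+(1-\lambda)T^D$ for $\lambda\in[0,1]$. $S\otimes T$ acts on the Hilbert space tensor product $\mathcal{H}_1\otimes\mathcal{H}_2$ by $(S\otimes T)(x\otimes y)=Sx\otimes Ty$, and $T\otimes S$ acts likewise on $\mathcal{H}_2\otimes\mathcal{H}_1$. $r_\sigma$ is the spectral radius and $r_\omega(A)=\sup_{\|x\|=1}|\langle Ax,x\rangle|$ the numerical radius. *)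

theory Defs
  imports "HOL-Analysis.Analysis" "HOL-Library.Nonpos_Ints"
begin

section \<open>Complex Hilbert spaces\<close>

text \<open>
  A complex inner product space is presented on top of the class of real inner product spaces:
  the underlying real inner product is the real part of the complex one. The norm is therefore
  the usual \<open>sqrt \<langle>x, x\<rangle>\<close>, and the library's theory of bounded linear maps
  and operator norms applies. The complex inner product is linear in its first argument.
\<close>

class complex_inner = real_inner +
  fixes scaleC :: "complex \<Rightarrow> 'a \<Rightarrow> 'a"  (infixr \<open>*\<^sub>C\<close> 75)
    and cinner :: "'a \<Rightarrow> 'a \<Rightarrow> complex"
  assumes scaleC_add_right: "c *\<^sub>C (x + y) = c *\<^sub>C x + c *\<^sub>C y"
    and scaleC_add_left: "(c + d) *\<^sub>C x = c *\<^sub>C x + d *\<^sub>C x"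
    and scaleC_scaleC: "c *\<^sub>C (d *\<^sub>C x) = (c * d) *\<^sub>C x"
    and scaleR_scaleC: "r *\<^sub>R x = complex_of_real r *\<^sub>C x"
    and cinner_commute: "cinner x y = cnj (cinner y x)"
    and cinner_add_left: "cinner (x + y) z = cinner x z + cinner y z"
    and cinner_scaleC_left: "cinner (c *\<^sub>C x) y = c * cinner x y"
    and inner_eq_Re_cinner: "inner x y = Re (cinner x y)"

class chilbert_space = complex_inner + complete_space
begin

subclass banach ..

end

lemma scaleC_one: "1 *\<^sub>C x = (x :: 'a::complex_inner)"
  using scaleR_scaleC[of 1 x] by simp

global_interpretation complex_vector: vector_space "scaleC :: complex \<Rightarrow> 'a::complex_inner \<Rightarrow> 'a"
  by unfold_locales (simp_all add: scaleC_add_right scaleC_add_left scaleC_scaleC scaleC_one)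

instantiation complex :: chilbert_space
begin

definition scaleC_complex :: "complex \<Rightarrow> complex \<Rightarrow> complex"
  where "scaleC_complex c x = c * x"

definition cinner_complex :: "complex \<Rightarrow> complex \<Rightarrow> complex"
  where "cinner_complex x y = x * cnj y"

instance
  by standard
    (simp_all add: scaleC_complex_def cinner_complex_def algebra_simps inner_complex_def
      scaleR_conv_of_real)

end


section \<open>Bounded operators\<close>

definition bounded_clinear :: "('a::complex_inner \<Rightarrow> 'b::complex_inner) \<Rightarrow> bool"
  where "bounded_clinear T \<longleftrightarrow> bounded_linear T \<and> (\<forall>c x. T (c *\<^sub>C x) = c *\<^sub>C T x)"

definition cadjoint :: "('a::complex_inner \<Rightarrow> 'b::complex_inner) \<Rightarrow> 'b \<Rightarrow> 'a"
  where "cadjoint T = (THE A. \<forall>x y. cinner (T x) y = cinner x (A y))"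

definition unitary_op :: "('a::complex_inner \<Rightarrow> 'a) \<Rightarrow> bool"
  where "unitary_op U \<longleftrightarrow>
    bounded_clinear U \<and> cadjoint U \<circ> U = id \<and> U \<circ> cadjoint U = id"

definition positive_op :: "('a::complex_inner \<Rightarrow> 'a) \<Rightarrow> bool"
  where "positive_op P \<longleftrightarrow> bounded_clinear P \<and> (\<forall>x. cinner (P x) x \<in> \<real>\<^sub>\<ge>\<^sub>0)"

definition sqrt_op :: "('a::complex_inner \<Rightarrow> 'a) \<Rightarrow> 'a \<Rightarrow> 'a"
  where "sqrt_op A = (THE P. positive_op P \<and> P \<circ> P = A)"

definition abs_op :: "('a::complex_inner \<Rightarrow> 'b::complex_inner) \<Rightarrow> 'a \<Rightarrow> 'a"
  where "abs_op T = sqrt_op (cadjoint T \<circ> T)"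

definition op_kernel :: "('a::complex_inner \<Rightarrow> 'b::complex_inner) \<Rightarrow> 'a set"
  where "op_kernel T = {x. T x = 0}"

definition partial_isometry :: "('a::complex_inner \<Rightarrow> 'b::complex_inner) \<Rightarrow> bool"
  where "partial_isometry V \<longleftrightarrow>
    bounded_clinear V \<and>
    (\<forall>x. (\<forall>z\<in>op_kernel V. cinner x z = 0) \<longrightarrow> norm (V x) = norm x)"

definition polar_isometry :: "('a::complex_inner \<Rightarrow> 'b::complex_inner) \<Rightarrow> 'a \<Rightarrow> 'b"
  where "polar_isometry T =
    (THE V. partial_isometry V \<and> op_kernel V = op_kernel T \<and> T = V \<circ> abs_op T)"

definition duggal_transform :: "('a::complex_inner \<Rightarrow> 'a) \<Rightarrow> 'a \<Rightarrow> 'a"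
  where "duggal_transform T = abs_op T \<circ> polar_isometry T"

definition mean_transform :: "real \<Rightarrow> ('a::complex_inner \<Rightarrow> 'a) \<Rightarrow> 'a \<Rightarrow> 'a"
  where "mean_transform l T = (\<lambda>x. l *\<^sub>R T x + (1 - l) *\<^sub>R duggal_transform T x)"


section \<open>Spectral radius and numerical radius\<close>

definition cspectrum :: "('a::complex_inner \<Rightarrow> 'a) \<Rightarrow> complex set"
  where "cspectrum A =
    {z. \<not> (\<exists>B. bounded_clinear B \<and>
              B \<circ> (\<lambda>x. A x - z *\<^sub>C x) = id \<and> (\<lambda>x. A x - z *\<^sub>C x) \<circ> B = id)}"

text \<open>
  On the zero space the two suprema below range over the empty set, and have the fixed real
  value \<open>Sup {}\<close>. On every other Hilbert space they range over nonempty bounded sets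
  when the operator is bounded.
\<close>

definition spectral_radius :: "('a::complex_inner \<Rightarrow> 'a) \<Rightarrow> real"
  where "spectral_radius A = (SUP z\<in>cspectrum A. cmod z)"

definition numerical_radius :: "('a::complex_inner \<Rightarrow> 'a) \<Rightarrow> real"
  where "numerical_radius A = (SUP x\<in>{x. norm x = 1}. cmod (cinner (A x) x))"


section \<open>Hilbert space tensor products\<close>

text \<open>
  The Hilbert space tensor product of two spaces is determined up to unitary equivalence: it is a
  Hilbert space with a bilinear map \<open>(x, y) \<mapsto> x \<otimes> y\<close> such that
  \<open>\<langle>x \<otimes> y, x' \<otimes> y'\<rangle> = \<langle>x, x'\<rangle> \<langle>y, y'\<rangle>\<close>
  and such that the elementary tensors have dense linear span. The predicate below says that the
  Hilbert space \<open>'c\<close>, with the map \<open>t\<close> as \<open>\<otimes>\<close>, is such a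
  tensor product.
\<close>

definition hilbert_tensor ::
    "('a::chilbert_space \<Rightarrow> 'b::chilbert_space \<Rightarrow> 'c::chilbert_space) \<Rightarrow> bool"
  where "hilbert_tensor t \<longleftrightarrow>
    (\<forall>x x' y. t (x + x') y = t x y + t x' y) \<and>
    (\<forall>x y y'. t x (y + y') = t x y + t x y') \<and>
    (\<forall>c x y. t (c *\<^sub>C x) y = c *\<^sub>C t x y) \<and>
    (\<forall>c x y. t x (c *\<^sub>C y) = c *\<^sub>C t x y) \<and>
    (\<forall>x x' y y'. cinner (t x y) (t x' y') = cinner x x' * cinner y y') \<and>
    closure (complex_vector.span {t x y | x y. True}) = UNIV"

lemma cinner_scaleC_right: "cinner x (c *\<^sub>C y) = cnj c * cinner x y"
  for x y :: "'a::complex_inner"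
  by (metis cinner_commute cinner_scaleC_left complex_cnj_mult)

lemma hilbert_tensor_scaleC:
  "hilbert_tensor (scaleC :: complex \<Rightarrow> 'a \<Rightarrow> 'a::chilbert_space)"
proof -
  have "x \<in> {c *\<^sub>C y | c y. True}" for x :: 'a
    using scaleC_one[of x] by (metis (mono_tags, lifting) mem_Collect_eq)
  then have "{c *\<^sub>C y | c y. True} = (UNIV :: 'a set)"
    by blast
  then show ?thesis
    unfolding hilbert_tensor_def
    by (simp add: scaleC_add_right scaleC_add_left scaleC_scaleC scaleC_complex_def
        cinner_complex_def cinner_scaleC_left cinner_scaleC_right mult_ac complex_vector.span_UNIV)
qed

definition tensor_op ::
    "('a::chilbert_space \<Rightarrow> 'b::chilbert_space \<Rightarrow> 'c::chilbert_space) \<Rightarrow>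
      ('a \<Rightarrow> 'a) \<Rightarrow> ('b \<Rightarrow> 'b) \<Rightarrow> 'c \<Rightarrow> 'c"
  where "tensor_op t A B =
    (THE W. bounded_clinear W \<and> (\<forall>x y. W (t x y) = t (A x) (B y)))"

end

theory Submission
  imports Defs
begin

text \<open>
  Modulus and polar decomposition are characterised uniquely; hence the mean transform commutes with
  conjugation by a unitary between two Hilbert spaces, and the flip
  \<open>x \<otimes> y \<mapsto> y \<otimes> x\<close> is such a unitary carrying \<open>S \<otimes> T\<close> to
  \<open>T \<otimes> S\<close>. Spectrum, numerical range and norm are unitary invariants. Because the
  notions involved are definite descriptions, this rests on existence and uniqueness of adjoints,
  positive square roots, polar decompositions and tensor products of operators.
\<close>

section \<open>Complex inner products\<close>

text \<open>The tensor product is known only through inner products of elementary tensors and their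
  density, so even boundedness of S \<otimes> T has to be read off Gram matrices. For K bounding S
  and Q the positive root of K^2 minus \<open>cadjoint S \<circ> S\<close>, one has K^2 <x, x'> = <S
  x, S x'> + <Q x, Q x'>. Multiplying by <y, y'> keeps the remainder a Gram matrix, that of the
  vectors Q x \<otimes> y, so positivity of a Schur product never needs a separate proof. The square
  root thus serves twice: for the modulus and for this defect. It is the limit of an iteration, and
  it commutes with every bounded operator that commutes with the given one; this yields uniqueness
  of the root. The two orders of the tensor product may be realised in different Hilbert spaces, so
  conjugation is set up between two spaces. Homogeneity is handled apart from conjugation: c splits
  into |c|, absorbed by the modulus, and the phase \<open>sgn c\<close>, absorbed by the partial
  isometry.\<close>

lemma cinner_add_right: "cinner x (y + z) = cinner x y + cinner x z"
  for x y z :: "'a::complex_inner"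
  by (metis cinner_commute cinner_add_left complex_cnj_add)

lemma scaleC_minus_one: "(- 1) *\<^sub>C x = - x" for x :: "'a::complex_inner"
  using complex_vector.scale_minus_left[of 1 x] by (simp add: scaleC_one)

lemma cinner_minus_left: "cinner (- x) y = - cinner x y"
  for x y :: "'a::complex_inner"
  using cinner_scaleC_left[of "-1" x y] by (simp add: scaleC_minus_one)

lemma cinner_minus_right: "cinner x (- y) = - cinner x y"
  for x y :: "'a::complex_inner"
  using cinner_scaleC_right[of x "-1" y] by (simp add: scaleC_minus_one)

lemma cinner_diff_left: "cinner (x - y) z = cinner x z - cinner y z"
  for x y z :: "'a::complex_inner"
  using cinner_add_left[of x "- y" z] by (simp add: cinner_minus_left)

lemma cinner_diff_right: "cinner x (y - z) = cinner x y - cinner x z"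
  for x y z :: "'a::complex_inner"
  using cinner_add_right[of x y "- z"] by (simp add: cinner_minus_right)

lemma cinner_zero_left [simp]: "cinner 0 y = 0"
  for y :: "'a::complex_inner"
  using cinner_diff_left[of 0 0 y] by simp

lemma cinner_zero_right [simp]: "cinner x 0 = 0"
  for x :: "'a::complex_inner"
  using cinner_diff_right[of x 0 0] by simp

lemma cinner_scaleR_left: "cinner (r *\<^sub>R x) y = of_real r * cinner x y"
  for x y :: "'a::complex_inner"
  by (simp add: scaleR_scaleC cinner_scaleC_left)

lemma cinner_scaleR_right: "cinner x (r *\<^sub>R y) = of_real r * cinner x y"
  for x y :: "'a::complex_inner"
  by (simp add: scaleR_scaleC cinner_scaleC_right)

lemmas cinner_simps = cinner_add_left cinner_add_right cinner_diff_left cinner_diff_right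
  cinner_minus_left cinner_minus_right cinner_scaleR_left cinner_scaleR_right
  cinner_scaleC_left cinner_scaleC_right

lemma cinner_self: "cinner x x = of_real ((norm x)\<^sup>2)"
  for x :: "'a::complex_inner"
proof -
  have "Im (cinner x x) = 0"
    using arg_cong[OF cinner_commute[of x x], of Im] by simp
  moreover have "Re (cinner x x) = (norm x)\<^sup>2"
    by (simp add: power2_norm_eq_inner inner_eq_Re_cinner)
  ultimately show ?thesis by (simp add: complex_eq_iff)
qed

lemma norm_scaleC: "norm (c *\<^sub>C x) = cmod c * norm x"
  for x :: "'a::complex_inner"
proof -
  have "complex_of_real ((norm (c *\<^sub>C x))\<^sup>2) = of_real ((cmod c * norm x)\<^sup>2)"
    unfolding cinner_self[symmetric] cinner_scaleC_left cinner_scaleC_right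
    by (simp add: cinner_self power_mult_distrib complex_norm_square mult_ac del: of_real_power)
  then have "(norm (c *\<^sub>C x))\<^sup>2 = (cmod c * norm x)\<^sup>2"
    using of_real_eq_iff by blast
  then show ?thesis
    by (simp add: power2_eq_iff_nonneg)
qed

text \<open>Multiplying \<open>x\<close> by the conjugate phase of the inner product makes the
  latter real and nonnegative without changing norms, which reduces the bound to the real
  Cauchy-Schwarz inequality.\<close>

lemma norm_cinner: "cmod (cinner x y) \<le> norm x * norm y"
  for x y :: "'a::complex_inner"
proof (cases "cinner x y = 0")
  case False
  define c where "c = cnj (sgn (cinner x y))"
  have "cinner (c *\<^sub>C x) y = of_real (cmod (cinner x y))"
    using False
    by (simp add: c_def cinner_scaleC_left sgn_eq complex_norm_square[symmetric] mult.commute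
        power2_eq_square)
  then have "cmod (cinner x y) = inner (c *\<^sub>C x) y"
    by (simp add: inner_eq_Re_cinner)
  also have "\<dots> \<le> norm (c *\<^sub>C x) * norm y"
    by (rule norm_cauchy_schwarz)
  also have "\<dots> = norm x * norm y"
    using False by (simp add: norm_scaleC c_def norm_sgn)
  finally show ?thesis .
qed simp

lemma bounded_bilinear_cinner: "bounded_bilinear (cinner :: 'a::complex_inner \<Rightarrow> _)"
  by unfold_locales
    (auto simp: cinner_simps scaleR_conv_of_real intro!: exI[of _ 1] norm_cinner)

lemmas tendsto_cinner = bounded_bilinear.tendsto[OF bounded_bilinear_cinner]

lemma cinner_eqI: "(\<And>z. cinner x z = cinner y z) \<Longrightarrow> x = y"
  for x y :: "'a::complex_inner"
proof -
  assume "\<And>z. cinner x z = cinner y z"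
  then have "cinner (x - y) (x - y) = 0" by (simp add: cinner_diff_left)
  then show ?thesis by (simp add: cinner_self)
qed

lemma cinner_eqI_right: "(\<And>z. cinner z x = cinner z y) \<Longrightarrow> x = y"
  for x y :: "'a::complex_inner"
  by (metis cinner_commute cinner_eqI)

lemma norm_eq_of_cinner_eq:
  fixes x :: "'a::complex_inner" and y :: "'b::complex_inner"
  shows "cinner x x = cinner y y \<Longrightarrow> norm x = norm y"
  by (simp only: cinner_self of_real_eq_iff) (simp add: power2_eq_iff_nonneg)

section \<open>Bounded complex linear maps\<close>

lemma bounded_clinearI:
  assumes "\<And>x y. T (x + y) = T x + T y" "\<And>c x. T (c *\<^sub>C x) = c *\<^sub>C T x"
    "\<And>x. norm (T x) \<le> K * norm x"
  shows "bounded_clinear T"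
  unfolding bounded_clinear_def
  using assms by (auto intro!: bounded_linear_intro[of T K] simp: scaleR_scaleC mult.commute)

lemma bounded_clinear_bounded_linear: "bounded_clinear T \<Longrightarrow> bounded_linear T"
  by (simp add: bounded_clinear_def)

lemma bounded_clinear_scaleC: "bounded_clinear T \<Longrightarrow> T (c *\<^sub>C x) = c *\<^sub>C T x"
  by (simp add: bounded_clinear_def)

lemma bounded_clinear_linear: "bounded_clinear T \<Longrightarrow> linear T"
  by (simp add: bounded_clinear_def bounded_linear.linear)

lemmas bounded_clinear_add = linear_add[OF bounded_clinear_linear]
lemmas bounded_clinear_diff = linear_diff[OF bounded_clinear_linear]
lemmas bounded_clinear_zero = linear_0[OF bounded_clinear_linear]
lemmas bounded_clinear_scaleR = linear_scale[OF bounded_clinear_linear]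
lemmas bounded_clinear_simps =
  bounded_clinear_add bounded_clinear_diff bounded_clinear_zero bounded_clinear_scaleR
  bounded_clinear_scaleC

lemma bounded_clinear_tendsto:
  "bounded_clinear T \<Longrightarrow> (f \<longlongrightarrow> x) F \<Longrightarrow> ((\<lambda>n. T (f n)) \<longlongrightarrow> T x) F"
  by (rule bounded_linear.tendsto[OF bounded_clinear_bounded_linear])

lemma bounded_clinear_bound:
  assumes "bounded_clinear T"
  obtains K where "K > 0" "\<And>x. norm (T x) \<le> K * norm x"
  using bounded_linear.pos_bounded[OF bounded_clinear_bounded_linear[OF assms]]
  by (metis mult.commute)

lemma bounded_clinear_compose:
  "bounded_clinear S \<Longrightarrow> bounded_clinear T \<Longrightarrow> bounded_clinear (S \<circ> T)"
  by (auto simp: bounded_clinear_def o_def intro: bounded_linear_compose)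

lemma bounded_clinear_id: "bounded_clinear id"
  by (rule bounded_clinearI[of _ 1]) auto

lemma bounded_clinear_plus:
  "bounded_clinear S \<Longrightarrow> bounded_clinear T \<Longrightarrow> bounded_clinear (\<lambda>x. S x + T x)"
  by (auto simp: bounded_clinear_def bounded_linear_add scaleC_add_right)

lemma bounded_clinear_minus:
  "bounded_clinear S \<Longrightarrow> bounded_clinear T \<Longrightarrow> bounded_clinear (\<lambda>x. S x - T x)"
  by (auto simp: bounded_clinear_def bounded_linear_sub complex_vector.scale_right_diff_distrib)

lemma bounded_clinear_scaleC_left:
  assumes "bounded_clinear S"
  shows "bounded_clinear (\<lambda>x. c *\<^sub>C S x)"
proof -
  obtain K where K: "\<And>x. norm (S x) \<le> K * norm x"
    using bounded_clinear_bound[OF assms] by metis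
  show ?thesis
  proof (rule bounded_clinearI[of _ "cmod c * K"])
    show "norm (c *\<^sub>C S x) \<le> cmod c * K * norm x" for x
      using mult_left_mono[OF K[of x] norm_ge_zero[of c]] by (simp add: norm_scaleC mult_ac)
  qed (simp_all add: bounded_clinear_simps[OF assms] scaleC_add_right mult.commute)
qed

lemma bounded_clinear_scaleR_left:
  "bounded_clinear S \<Longrightarrow> bounded_clinear (\<lambda>x. r *\<^sub>R S x)"
  by (simp add: scaleR_scaleC bounded_clinear_scaleC_left)

section \<open>Minimisation on subspaces\<close>

text \<open>A parabola through the origin with nonzero slope there becomes negative. The test point
  is \<open>- d / (a + 1)\<close> rather than the minimiser \<open>- d / a\<close>, which treats
  \<open>a = 0\<close> uniformly.\<close>

lemma linear_coeff_zero_of_quadratic_nonneg: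
  fixes a d :: real
  assumes ineq: "\<And>t. 0 \<le> t\<^sup>2 * a + 2 * t * d" and a: "a \<ge> 0"
  shows "d = 0"
proof -
  define s where "s = a + 1"
  have s: "s > 0" "a = s - 1"
    using a by (simp_all add: s_def)
  have "0 \<le> (- d / s)\<^sup>2 * (s - 1) + 2 * (- d / s) * d"
    using ineq[of "- d / s"] s by simp
  also have "\<dots> = - (d\<^sup>2 * (s + 1)) / s\<^sup>2"
    using s(1) by (simp add: field_simps power2_eq_square)
  finally have "d\<^sup>2 * (s + 1) \<le> 0"
    using s(1) by (simp add: divide_le_0_iff zero_le_divide_iff)
  then show "d = 0" using s(1) by (simp add: mult_le_0_iff)
qed

text \<open>The minimiser of \<open>\<parallel>x\<parallel>\<^sup>2 - 2 f x\<close> over \<open>M\<close> represents \<open>f\<close>; the parallelogram law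
  makes minimising sequences Cauchy.\<close>

lemma real_riesz_on_closed_subspace:
  fixes f :: "'a::{real_inner,complete_space} \<Rightarrow> real"
  assumes f: "bounded_linear f" and M: "subspace M" "closed M"
  obtains y where "y \<in> M" "\<And>x. x \<in> M \<Longrightarrow> f x = inner x y"
proof -
  interpret f: bounded_linear f by fact
  obtain K where K: "\<And>x. norm (f x) \<le> norm x * K"
    using f.bounded by blast
  define \<phi> where "\<phi> x = inner x x - 2 * f x" for x
  \<comment> \<open>Completing the square in |x| bounds \<phi> from below, so the infimum
    \<open>m\<close> is finite.\<close>
  have lb: "\<phi> x \<ge> - (K\<^sup>2)" for x
  proof -
    have "\<phi> x \<ge> (norm x)\<^sup>2 - 2 * (norm x * K)"
      using K[of x] by (simp add: \<phi>_def power2_norm_eq_inner)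
    moreover have "(norm x - K)\<^sup>2 \<ge> 0" by simp
    ultimately show ?thesis by (simp add: power2_eq_square algebra_simps)
  qed
  define m where "m = Inf (\<phi> ` M)"
  have bdd: "bdd_below (\<phi> ` M)"
    using lb by (auto intro!: bdd_belowI)
  have ne: "\<phi> ` M \<noteq> {}" using subspace_0[OF M(1)] by blast
  have m_le: "x \<in> M \<Longrightarrow> m \<le> \<phi> x" for x
    unfolding m_def using bdd by (simp add: cInf_lower)
  have "\<exists>x\<in>M. \<phi> x < m + 1 / (real n + 1)" for n
    using cInf_lessD[OF ne, of "m + 1 / (real n + 1)"] unfolding m_def[symmetric] by auto
  then obtain X where X: "\<And>n. X n \<in> M" "\<And>n. \<phi> (X n) < m + 1 / (real n + 1)"
    by metis
  have par: "(norm (x - y))\<^sup>2 = 2 * \<phi> x + 2 * \<phi> y - 4 * \<phi> ((1/2) *\<^sub>R (x + y))" for x y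
    by (simp add: \<phi>_def power2_norm_eq_inner f.add f.scaleR inner_diff_left inner_diff_right
        inner_add_left inner_add_right inner_commute algebra_simps)
  \<comment> \<open>The midpoint stays in \<open>M\<close>, where \<phi> is at least
    \<open>m\<close>; the four copies of \<open>m\<close> cancel and only the two errors
    remain.\<close>
  have dist: "(norm (X p - X q))\<^sup>2 \<le> 2 / (real p + 1) + 2 / (real q + 1)" for p q
  proof -
    have "(1/2) *\<^sub>R (X p + X q) \<in> M"
      using X(1) M(1) by (simp add: subspace_add subspace_scale)
    from m_le[OF this] X(2)[of p] X(2)[of q] par[of "X p" "X q"] show ?thesis
      by argo
  qed
  have "Cauchy X"
  proof (rule CauchyI)
    fix e :: real assume e: "e > 0"
    obtain N :: nat where N: "4 / e\<^sup>2 < real N"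
      using reals_Archimedean2 by blast
    have "norm (X p - X q) < e" if "p \<ge> N" "q \<ge> N" for p q
    proof -
      have *: "2 / (real k + 1) < e\<^sup>2 / 2" if "k \<ge> N" for k
      proof -
        have "4 / e\<^sup>2 < real k + 1" using N that by linarith
        then show ?thesis using e by (simp add: field_simps)
      qed
      have "(norm (X p - X q))\<^sup>2 < e\<^sup>2"
        using dist[of p q] *[OF that(1)] *[OF that(2)] by linarith
      then show ?thesis using e by (simp add: power2_less_imp_less)
    qed
    then show "\<exists>N. \<forall>p\<ge>N. \<forall>q\<ge>N. norm (X p - X q) < e" by blast
  qed
  then obtain y where y: "X \<longlonglongrightarrow> y"
    using Cauchy_convergent convergent_def by blast
  have yM: "y \<in> M" using closed_sequentially[OF M(2) _ y] X(1) by blast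
  have "(\<lambda>n. \<phi> (X n)) \<longlonglongrightarrow> \<phi> y"
    unfolding \<phi>_def by (intro tendsto_intros f.tendsto y)
  moreover have "(\<lambda>n. m + 1 / (real n + 1)) \<longlonglongrightarrow> m"
    using LIMSEQ_inverse_real_of_nat_add[of m] by (simp add: inverse_eq_divide add.commute)
  ultimately have le: "\<phi> y \<le> m"
    using X(2) by (meson LIMSEQ_le less_imp_le)
  have "f x = inner x y" if x: "x \<in> M" for x
  proof -
    \<comment> \<open>First variation at the minimiser \<open>y\<close> in direction
      \<open>x\<close>: the linear coefficient must vanish.\<close>
    have ineq: "0 \<le> t\<^sup>2 * inner x x + 2 * t * (inner x y - f x)" for t
    proof -
      have "y + t *\<^sub>R x \<in> M" using x yM M(1) by (simp add: subspace_add subspace_scale)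
      from m_le[OF this] le have "\<phi> y \<le> \<phi> (y + t *\<^sub>R x)" by linarith
      then show ?thesis
        by (simp add: \<phi>_def f.add f.scaleR inner_add_left inner_add_right inner_commute
            power2_eq_square algebra_simps)
    qed
    from linear_coeff_zero_of_quadratic_nonneg[OF this inner_ge_zero] show ?thesis by simp
  qed
  with yM show ?thesis using that by blast
qed

lemma subspace_closure:
  fixes M :: "'a::real_normed_vector set"
  assumes "subspace M"
  shows "subspace (closure M)"
proof (rule subspaceI)
  show "0 \<in> closure M" using subspace_0[OF assms] closure_subset by blast
  show "x + y \<in> closure M" if xy: "x \<in> closure M" "y \<in> closure M" for x y
  proof -
    obtain f g where "\<And>n. f n \<in> M" "f \<longlonglongrightarrow> x" "\<And>n. g n \<in> M" "g \<longlonglongrightarrow> y"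
      using xy unfolding closure_sequential by blast
    then have "(\<forall>n. f n + g n \<in> M) \<and> (\<lambda>n. f n + g n) \<longlonglongrightarrow> x + y"
      by (auto intro: subspace_add[OF assms] tendsto_add)
    then show ?thesis
      unfolding closure_sequential by (rule exI[where x = "\<lambda>n. f n + g n"])
  qed
  show "r *\<^sub>R x \<in> closure M" if x: "x \<in> closure M" for r x
  proof -
    obtain f where "\<And>n. f n \<in> M" "f \<longlonglongrightarrow> x"
      using x unfolding closure_sequential by blast
    then have "(\<forall>n. r *\<^sub>R f n \<in> M) \<and> (\<lambda>n. r *\<^sub>R f n) \<longlonglongrightarrow> r *\<^sub>R x"
      by (auto intro: subspace_scale[OF assms] tendsto_intros)
    then show ?thesis
      unfolding closure_sequential by (rule exI[where x = "\<lambda>n. r *\<^sub>R f n"])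
  qed
qed

text \<open>The Riesz representative on \<open>closure M\<close> of the functional given by
  \<open>x\<close> is the orthogonal projection of \<open>x\<close>; the difference is orthogonal to
  \<open>M\<close>, hence zero.\<close>

lemma dense_of_zero_complement:
  fixes M :: "'a::chilbert_space set"
  assumes "subspace M" and "\<And>x. (\<And>m. m \<in> M \<Longrightarrow> inner x m = 0) \<Longrightarrow> x = 0"
  shows "closure M = UNIV"
proof -
  have "x \<in> closure M" for x
  proof -
    obtain y where y: "y \<in> closure M" "\<And>z. z \<in> closure M \<Longrightarrow> inner z x = inner z y"
      using real_riesz_on_closed_subspace[of "\<lambda>z. inner z x" "closure M"]
        bounded_linear_inner_left subspace_closure[OF assms(1)] closed_closure by blast
    have "x - y = 0"
    proof (rule assms(2))
      fix m assume "m \<in> M"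
      then have "inner m x = inner m y" using y(2) closure_subset by blast
      then show "inner (x - y) m = 0" by (simp add: inner_diff_right inner_commute[of _ m])
    qed
    then show ?thesis using y(1) by simp
  qed
  then show ?thesis by blast
qed

section \<open>Adjoints\<close>

text \<open>The real part of \<open>f\<close> is represented in the real inner product, and the same
  vector works for the imaginary part because Re (f (i x)) = - Im (f x).\<close>

lemma riesz:
  fixes f :: "'a::chilbert_space \<Rightarrow> complex"
  assumes "bounded_clinear f"
  obtains y where "\<And>x. f x = cinner x y"
proof -
  have "bounded_linear (\<lambda>x. Re (f x))"
    by (rule bounded_linear_compose[OF bounded_linear_Re bounded_clinear_bounded_linear[OF assms]])
  from real_riesz_on_closed_subspace[OF this subspace_UNIV closed_UNIV]
  obtain y where y: "\<And>x. Re (f x) = inner x y" by auto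
  have "f x = cinner x y" for x
    using y[of x] y[of "\<i> *\<^sub>C x"]
    by (auto simp: inner_eq_Re_cinner bounded_clinear_scaleC[OF assms] cinner_scaleC_left
        scaleC_complex_def complex_eq_iff)
  then show ?thesis using that by blast
qed

lemma cadjointI:
  fixes T :: "'a::complex_inner \<Rightarrow> 'b::complex_inner"
  assumes "\<And>x y. cinner (T x) y = cinner x (A y)"
  shows "cadjoint T = A"
  unfolding cadjoint_def
proof (rule the_equality)
  fix A' assume "\<forall>x y. cinner (T x) y = cinner x (A' y)"
  then have "cinner x (A' y) = cinner x (A y)" for x y using assms by metis
  then show "A' = A" by (metis cinner_eqI_right ext)
qed (use assms in blast)

lemma cinner_cadjoint:
  fixes T :: "'a::chilbert_space \<Rightarrow> 'b::complex_inner"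
  assumes T: "bounded_clinear T"
  shows "cinner (T x) y = cinner x (cadjoint T y)"
proof -
  have "\<exists>z. \<forall>x. cinner (T x) y = cinner x z" for y
  proof -
    obtain K where K: "\<And>x. norm (T x) \<le> K * norm x"
      using bounded_clinear_bound[OF T] by metis
    have "bounded_clinear (\<lambda>x. cinner (T x) y)"
    proof (rule bounded_clinearI[of _ "K * norm y"])
      show "norm (cinner (T x) y) \<le> K * norm y * norm x" for x
        using norm_cinner[of "T x" y] mult_right_mono[OF K[of x] norm_ge_zero[of y]]
        by (simp add: mult_ac)
    qed (simp_all add: bounded_clinear_simps[OF T] cinner_simps scaleC_complex_def)
    then show ?thesis by (metis riesz)
  qed
  then obtain A where "\<And>x y. cinner (T x) y = cinner x (A y)" by metis
  with cadjointI[of T A] show ?thesis by simp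
qed

text \<open>Testing against the vector \<open>cadjoint T y\<close> itself bounds its squared norm by
  K times its norm times |y|. The constant is inherited unchanged, as the later contraction
  estimates for the modulus and the defect require.\<close>

lemma bounded_clinear_cadjoint:
  fixes T :: "'a::chilbert_space \<Rightarrow> 'b::complex_inner"
  assumes T: "bounded_clinear T" and K: "\<And>x. norm (T x) \<le> K * norm x" "0 \<le> K"
  shows "bounded_clinear (cadjoint T)" "norm (cadjoint T y) \<le> K * norm y"
proof -
  have adj: "cinner z (cadjoint T y) = cinner (T z) y" for z y
    by (simp add: cinner_cadjoint[OF T])
  show bd: "norm (cadjoint T y) \<le> K * norm y" for y
  proof (cases "cadjoint T y = 0")
    case True
    then show ?thesis using K(2) by simp
  next
    case False
    let ?z = "cadjoint T y"
    have "(norm ?z)\<^sup>2 = cmod (cinner (T ?z) y)"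
      unfolding adj[symmetric] cinner_self by (simp add: norm_power)
    also have "\<dots> \<le> K * norm ?z * norm y"
      using norm_cinner[of "T ?z" y] mult_right_mono[OF K(1)[of ?z] norm_ge_zero[of y]] by linarith
    finally show ?thesis using False by (simp add: power2_eq_square)
  qed
  show "bounded_clinear (cadjoint T)"
    by (rule bounded_clinearI[OF _ _ bd]; rule cinner_eqI_right)
      (simp_all add: adj cinner_simps)
qed

section \<open>Positive square roots\<close>

text \<open>Polarisation: the defect \<open>d\<close> is sesquilinear and vanishes on the diagonal
  because the quadratic form is real; the vectors x + y and i x + y then give d x y + d y x = 0 and
  d x y = d y x.\<close>

lemma positive_op_self_adjoint:
  assumes "positive_op P"
  shows "cinner (P x) y = cinner x (P y)"
proof -
  have P: "bounded_clinear P" using assms by (simp add: positive_op_def)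
  define d where "d x y = cinner (P x) y - cinner x (P y)" for x y
  have dd: "d x x = 0" for x
  proof -
    have "cinner (P x) x \<in> \<real>\<^sub>\<ge>\<^sub>0" using assms by (simp add: positive_op_def)
    then have "cnj (cinner (P x) x) = cinner (P x) x"
      by (simp add: complex_nonneg_Reals_iff complex_eq_iff)
    then show ?thesis by (simp add: d_def cinner_commute[of x])
  qed
  have "d x y + d y x = 0"
    using dd[of "x + y"] dd[of x] dd[of y]
    by (simp add: d_def cinner_simps bounded_clinear_simps[OF P] algebra_simps)
  moreover have "\<i> * (d x y - d y x) = 0"
    using dd[of "\<i> *\<^sub>C x + y"] dd[of x] dd[of y]
    by (simp add: d_def cinner_simps bounded_clinear_simps[OF P] algebra_simps)
  ultimately have "d x y = 0" by simp
  then show ?thesis by (simp add: d_def)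
qed

text \<open>Along the line y + t P y the nonnegative form has no constant term, and its linear
  coefficient is a multiple of |P y|^2, which therefore vanishes.\<close>

lemma positive_op_zero:
  assumes "positive_op P" and "cinner (P y) y = 0"
  shows "P y = 0"
proof -
  have P: "bounded_clinear P" using assms by (simp add: positive_op_def)
  have pos: "0 \<le> Re (cinner (P x) x)" for x
    using assms(1) by (simp add: positive_op_def complex_nonneg_Reals_iff)
  define z where "z = P y"
  have "0 \<le> t\<^sup>2 * Re (cinner (P z) z) + 2 * t * (norm z)\<^sup>2" for t
  proof -
    have "cinner (P z) y = cinner z z"
      using positive_op_self_adjoint[OF assms(1), of z y] by (simp add: z_def)
    then have "cinner (P (y + t *\<^sub>R z)) (y + t *\<^sub>R z) =
        of_real (t\<^sup>2) * cinner (P z) z + of_real (2 * t * (norm z)\<^sup>2)"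
      using assms(2)
      by (simp add: cinner_simps bounded_clinear_simps[OF P] z_def[symmetric] cinner_self
          power2_eq_square algebra_simps)
    then show ?thesis using pos[of "y + t *\<^sub>R z"] by (simp add: mult.commute[of "t\<^sup>2"])
  qed
  from linear_coeff_zero_of_quadratic_nonneg[OF this pos] show ?thesis
    by (simp add: z_def)
qed

lemma positive_op_scaleR:
  "positive_op P \<Longrightarrow> 0 \<le> r \<Longrightarrow> positive_op (\<lambda>x. r *\<^sub>R P x)"
  by (auto simp: positive_op_def cinner_scaleR_left complex_nonneg_Reals_iff
      intro: bounded_clinear_scaleR_left)

text \<open>Iterating \<open>Y \<mapsto> (B + Y\<^sup>2) / 2\<close> leads to a solution of \<open>(1 - Y)\<^sup>2 = 1 - B\<close>.\<close>

primrec sqrt_iter :: "('a::complex_inner \<Rightarrow> 'a) \<Rightarrow> nat \<Rightarrow> 'a \<Rightarrow> 'a" where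
  "sqrt_iter B 0 = (\<lambda>x. 0)"
| "sqrt_iter B (Suc n) = (\<lambda>x. (1/2) *\<^sub>R (B x + sqrt_iter B n (sqrt_iter B n x)))"

text \<open>The same iteration for the scalar \<open>B = 1\<close>: it increases to \<open>1\<close>, and its increments
  dominate those of \<^term>\<open>sqrt_iter B\<close> in norm when \<open>B\<close> is a contraction.\<close>

primrec sqrt_majorant :: "nat \<Rightarrow> real" where
  "sqrt_majorant 0 = 0"
| "sqrt_majorant (Suc n) = (1 + (sqrt_majorant n)\<^sup>2) / 2"

section \<open>Convergence of the square root iteration\<close>

lemma sqrt_majorant_bounds: "0 \<le> sqrt_majorant n" "sqrt_majorant n \<le> 1"
  by (induction n) (simp_all add: power_le_one)

lemma sqrt_majorant_incseq: "sqrt_majorant n \<le> sqrt_majorant (Suc n)"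
proof -
  have "0 \<le> (sqrt_majorant n - 1)\<^sup>2" by simp
  then show ?thesis by (simp add: power2_eq_square algebra_simps)
qed

text \<open>The increments telescope, so summability is convergence of a bounded monotone sequence.
  They decay too slowly for a geometric bound.\<close>

lemma sqrt_majorant_summable: "summable (\<lambda>n. sqrt_majorant (Suc n) - sqrt_majorant n)"
proof -
  have "convergent sqrt_majorant"
    using sqrt_majorant_bounds sqrt_majorant_incseq
    by (intro Bseq_monoseq_convergent BseqI'[of _ 1])
      (auto simp: monoseq_Suc simp del: sqrt_majorant.simps)
  then show ?thesis
    using telescope_summable convergent_def by blast
qed

context
  fixes B :: "'a::chilbert_space \<Rightarrow> 'a"
  assumes B: "bounded_clinear B" and contr: "\<And>x. norm (B x) \<le> norm x"
    and selfadj: "\<And>x y. cinner (B x) y = cinner x (B y)"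
begin

lemma bounded_clinear_sqrt_iter: "bounded_clinear (sqrt_iter B n)"
proof (induction n)
  case 0
  then show ?case by (auto intro: bounded_clinearI[of _ 0])
next
  case (Suc n)
  then show ?case
    using bounded_clinear_scaleR_left[OF bounded_clinear_plus[OF B bounded_clinear_compose[OF Suc Suc]]]
    by (simp add: o_def)
qed

lemma norm_sqrt_iter_le: "norm (sqrt_iter B n x) \<le> sqrt_majorant n * norm x"
proof (induction n arbitrary: x)
  case (Suc n)
  have "norm (sqrt_iter B n (sqrt_iter B n x)) \<le> sqrt_majorant n * (sqrt_majorant n * norm x)"
    using Suc[of "sqrt_iter B n x"] mult_left_mono[OF Suc[of x] sqrt_majorant_bounds(1)[of n]]
    by linarith
  then show ?case
    using norm_triangle_ineq[of "B x" "sqrt_iter B n (sqrt_iter B n x)"] contr[of x]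
    by (simp add: power2_eq_square algebra_simps del: scaleR_right_distrib)
qed simp

text \<open>The identity Z^2 - Y^2 = Z (Z - Y) + (Z - Y) Y holds without commutativity. Replacing
  every factor by its scalar bound turns the right side into z^2 - y^2, so the scalar recursion
  reproduces itself.\<close>

lemma norm_sqrt_iter_diff_le:
  "norm (sqrt_iter B (Suc n) x - sqrt_iter B n x)
    \<le> (sqrt_majorant (Suc n) - sqrt_majorant n) * norm x"
proof (induction n arbitrary: x)
  case 0
  then show ?case using contr[of x] by simp
next
  case (Suc n)
  define Y where "Y = sqrt_iter B n"
  define Z where "Z = sqrt_iter B (Suc n)"
  define y where "y = sqrt_majorant n"
  define z where "z = sqrt_majorant (Suc n)"
  have IH: "norm (Z x - Y x) \<le> (z - y) * norm x" for x
    unfolding Z_def Y_def y_def z_def by (rule Suc)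
  have Zb: "norm (Z x) \<le> z * norm x" and Yb: "norm (Y x) \<le> y * norm x" for x
    unfolding Z_def Y_def y_def z_def by (rule norm_sqrt_iter_le)+
  have Zl: "bounded_clinear Z" unfolding Z_def by (rule bounded_clinear_sqrt_iter)
  have yz: "0 \<le> y" "0 \<le> z" "y \<le> z"
    unfolding y_def z_def by (rule sqrt_majorant_bounds sqrt_majorant_incseq)+
  have "sqrt_iter B (Suc (Suc n)) x - sqrt_iter B (Suc n) x
      = (1/2) *\<^sub>R (Z (Z x - Y x) + (Z (Y x) - Y (Y x)))"
  proof -
    have "sqrt_iter B (Suc (Suc n)) x = (1/2) *\<^sub>R (B x + Z (Z x))"
      by (simp only: sqrt_iter.simps(2)[of B "Suc n"] Z_def)
    moreover have "sqrt_iter B (Suc n) x = (1/2) *\<^sub>R (B x + Y (Y x))"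
      by (simp only: sqrt_iter.simps(2) Y_def)
    ultimately show ?thesis
      by (simp only: bounded_clinear_simps[OF Zl] scaleR_diff_right[symmetric]) simp
  qed
  also have "norm \<dots> \<le> (1/2) * (norm (Z (Z x - Y x)) + norm (Z (Y x) - Y (Y x)))"
    using norm_triangle_ineq[of "Z (Z x - Y x)"] by simp
  also have "\<dots> \<le> (1/2) * (z * ((z - y) * norm x) + (z - y) * (y * norm x))"
    using Zb[of "Z x - Y x"] IH[of "Y x"] mult_left_mono[OF IH[of x] yz(2)]
      mult_left_mono[OF Yb[of x], of "z - y"] yz(3)
    by simp
  also have "\<dots> = (sqrt_majorant (Suc (Suc n)) - sqrt_majorant (Suc n)) * norm x"
    unfolding sqrt_majorant.simps(2)[of "Suc n"] z_def[symmetric]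
    by (simp add: z_def y_def power2_eq_square field_simps)
  finally show ?case .
qed

lemma sqrt_iter_self_adjoint: "cinner (sqrt_iter B n x) y = cinner x (sqrt_iter B n y)"
  by (induction n arbitrary: x y) (simp_all add: cinner_simps selfadj)

lemma sqrt_iter_commute:
  assumes "bounded_clinear C" "\<And>x. C (B x) = B (C x)"
  shows "C (sqrt_iter B n x) = sqrt_iter B n (C x)"
  by (induction n arbitrary: x) (simp_all add: assms bounded_clinear_simps[OF assms(1)])

lemma sqrt_iter_convergent: "convergent (\<lambda>n. sqrt_iter B n x)"
proof -
  have "summable (\<lambda>n. sqrt_iter B (Suc n) x - sqrt_iter B n x)"
    by (rule summable_comparison_test'[OF summable_mult2[OF sqrt_majorant_summable]])
      (rule norm_sqrt_iter_diff_le)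
  then have "convergent (\<lambda>n. \<Sum>k<n. sqrt_iter B (Suc k) x - sqrt_iter B k x)"
    by (simp add: summable_iff_convergent)
  then show ?thesis
    using sum_lessThan_telescope[of "\<lambda>k. sqrt_iter B k x"] by (simp del: sqrt_iter.simps(2))
qed

text \<open>With Y the pointwise limit, the fixed point equation 2 Y = B + Y^2 gives (1 - Y)^2 = 1 -
  B, and positivity of 1 - Y follows from |Y x| \<le> |x|. The commutation clause, inherited from
  the iterates, prepares the uniqueness of roots.\<close>

lemma sqrt_one_minus_exists:
  obtains P where "positive_op P" "\<And>x. P (P x) = x - B x"
    "\<And>C x. bounded_clinear C \<Longrightarrow> (\<And>x. C (B x) = B (C x)) \<Longrightarrow> C (P x) = P (C x)"
proof -
  define Y where "Y x = lim (\<lambda>n. sqrt_iter B n x)" for x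
  note iter_simps = bounded_clinear_simps[OF bounded_clinear_sqrt_iter]
  have Y: "(\<lambda>n. sqrt_iter B n x) \<longlonglongrightarrow> Y x" for x
    using sqrt_iter_convergent unfolding Y_def by (simp add: convergent_LIMSEQ_iff)
  have contr_iter: "norm (sqrt_iter B n x) \<le> norm x" for n x
    using norm_sqrt_iter_le[of n x] mult_right_mono[OF sqrt_majorant_bounds(2)[of n] norm_ge_zero[of x]]
    by simp
  have Yb: "norm (Y x) \<le> norm x" for x
    by (rule LIMSEQ_le_const2[OF tendsto_norm[OF Y]]) (use contr_iter in blast)
  have Y_lin: "bounded_clinear Y"
  proof (rule bounded_clinearI[of _ 1])
    show "Y (x + y) = Y x + Y y" for x y
      using Y[of "x + y"] tendsto_add[OF Y[of x] Y[of y]]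
      by (auto simp: iter_simps intro: LIMSEQ_unique)
    show "Y (c *\<^sub>C x) = c *\<^sub>C Y x" for c x
    proof -
      have "bounded_clinear (\<lambda>x::'a. c *\<^sub>C x)"
        using bounded_clinear_scaleC_left[OF bounded_clinear_id] by simp
      from bounded_clinear_tendsto[OF this Y[of x]] Y[of "c *\<^sub>C x"] show ?thesis
        by (auto simp: iter_simps intro: LIMSEQ_unique)
    qed
  qed (simp add: Yb)
  \<comment> \<open>Convergence is established only pointwise, so the square is split: the iterates
    are contractions, hence \<open>sqrt_iter B n (sqrt_iter B n x - Y x)\<close> tends to 0, and the
    rest is convergence at the fixed vector \<open>Y x\<close>.\<close>
  have Y2: "Y x = (1/2) *\<^sub>R (B x + Y (Y x))" for x
  proof -
    have "(\<lambda>n. sqrt_iter B n (sqrt_iter B n x - Y x)) \<longlonglongrightarrow> 0"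
    proof (rule Lim_null_comparison)
      show "\<forall>\<^sub>F n in sequentially. norm (sqrt_iter B n (sqrt_iter B n x - Y x))
          \<le> norm (sqrt_iter B n x - Y x)"
        using contr_iter by simp
      show "(\<lambda>n. norm (sqrt_iter B n x - Y x)) \<longlonglongrightarrow> 0"
        using Y[of x] by (simp add: LIM_zero_iff tendsto_norm_zero)
    qed
    from tendsto_add[OF this Y[of "Y x"]]
    have "(\<lambda>n. sqrt_iter B n (sqrt_iter B n x)) \<longlonglongrightarrow> Y (Y x)"
      by (simp add: iter_simps)
    then have "(\<lambda>n. sqrt_iter B (Suc n) x) \<longlonglongrightarrow> (1/2) *\<^sub>R (B x + Y (Y x))"
      unfolding sqrt_iter.simps by (intro tendsto_intros)
    with LIMSEQ_Suc[OF Y[of x]] show ?thesis using LIMSEQ_unique by blast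
  qed
  define P where "P x = x - Y x" for x
  have P_lin: "bounded_clinear P"
    unfolding P_def using bounded_clinear_minus[OF bounded_clinear_id Y_lin] by simp
  have Y_adj: "cinner (Y x) y = cinner x (Y y)" for x y
    using tendsto_cinner[OF Y[of x] tendsto_const[of y]]
      tendsto_cinner[OF tendsto_const[of x] Y[of y]]
    by (auto simp: sqrt_iter_self_adjoint intro: LIMSEQ_unique)
  show ?thesis
  proof
    show "positive_op P"
      unfolding positive_op_def
    proof (intro conjI allI P_lin)
      fix x
      have "Im (cinner (Y x) x) = 0"
        using arg_cong[OF cinner_commute[of "Y x" x], of Im] by (simp add: Y_adj)
      moreover have "Re (cinner (Y x) x) \<le> norm x * norm x"
        using complex_Re_le_cmod[of "cinner (Y x) x"] norm_cinner[of "Y x" x]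
          mult_right_mono[OF Yb[of x] norm_ge_zero[of x]] by linarith
      ultimately show "cinner (P x) x \<in> \<real>\<^sub>\<ge>\<^sub>0"
        by (simp add: P_def cinner_simps cinner_self complex_nonneg_Reals_iff power2_eq_square)
    qed
    show "P (P x) = x - B x" for x
    proof -
      have "P (P x) = x - (Y x + Y x) + Y (Y x)"
        by (simp add: P_def bounded_clinear_simps[OF Y_lin])
      also have "Y x + Y x = B x + Y (Y x)"
        using Y2[of x] by (metis scaleR_2 scaleR_half_double scaleR_right_distrib)
      finally show ?thesis by simp
    qed
    show "C (P x) = P (C x)" if C: "bounded_clinear C" "\<And>x. C (B x) = B (C x)" for C x
    proof -
      have "C (Y x) = Y (C x)"
        using bounded_clinear_tendsto[OF C(1) Y[of x]] Y[of "C x"]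
        by (auto simp: sqrt_iter_commute[OF C] intro: LIMSEQ_unique)
      then show ?thesis by (simp add: P_def bounded_clinear_simps[OF C(1)])
    qed
  qed
qed

end

text \<open>Commutation gives (P + Q)(P - Q) x = 0. For y = (P - Q) x both nonnegative forms then
  vanish, so P y = Q y = 0, and |y|^2 = <x, (P - Q) y> = 0.\<close>

lemma commuting_positive_sqrt_unique:
  fixes P Q :: "'a::complex_inner \<Rightarrow> 'a"
  assumes P: "positive_op P" and Q: "positive_op Q"
    and comm: "\<And>x. P (Q x) = Q (P x)" and eq: "\<And>x. P (P x) = Q (Q x)"
  shows "P = Q"
proof
  fix x
  have lin: "bounded_clinear P" "bounded_clinear Q"
    using P Q by (simp_all add: positive_op_def)
  note simps = bounded_clinear_simps[OF lin(1)] bounded_clinear_simps[OF lin(2)]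
  define y where "y = P x - Q x"
  have "cinner (P y) y + cinner (Q y) y = cinner (P y + Q y) y"
    by (simp add: cinner_simps)
  also have "P y + Q y = 0"
    by (simp add: y_def simps comm eq)
  finally have sum0: "cinner (P y) y + cinner (Q y) y = 0" by simp
  have "cinner (P y) y \<in> \<real>\<^sub>\<ge>\<^sub>0" "cinner (Q y) y \<in> \<real>\<^sub>\<ge>\<^sub>0"
    using P Q by (simp_all add: positive_op_def)
  with sum0 have "cinner (P y) y = 0" "cinner (Q y) y = 0"
    by (auto simp: complex_nonneg_Reals_iff complex_eq_iff)
  then have "P y = 0" "Q y = 0"
    using positive_op_zero P Q by blast+
  then have "cinner y y = 0"
    using positive_op_self_adjoint[OF P, of x y] positive_op_self_adjoint[OF Q, of x y]
    by (simp add: y_def cinner_diff_left)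
  then show "P x = Q x" by (simp add: cinner_self y_def)
qed

text \<open>The contraction hypothesis encodes 0 \<le> A \<le> 2 K for self-adjoint A and lets the
  iteration run with B = 1 - A / K; the root is then rescaled by \<open>sqrt K\<close>. Any
  competing root Q commutes with Q^2 = A, hence with B and with the constructed root.\<close>

lemma positive_sqrt_ex1:
  fixes A :: "'a::chilbert_space \<Rightarrow> 'a"
  assumes A: "bounded_clinear A" and adj: "\<And>x y. cinner (A x) y = cinner x (A y)"
    and K: "K > 0" and contr: "\<And>x. norm (x - (1 / K) *\<^sub>R A x) \<le> norm x"
  shows "\<exists>!P. positive_op P \<and> P \<circ> P = A"
proof -
  define B where "B x = x - (1 / K) *\<^sub>R A x" for x
  have B: "bounded_clinear B"
    unfolding B_def
    using bounded_clinear_minus[OF bounded_clinear_id bounded_clinear_scaleR_left[OF A]] by simp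
  obtain P0 where P0: "positive_op P0" "\<And>x. P0 (P0 x) = x - B x"
      "\<And>C x. bounded_clinear C \<Longrightarrow> (\<And>x. C (B x) = B (C x)) \<Longrightarrow> C (P0 x) = P0 (C x)"
    using sqrt_one_minus_exists[OF B] contr adj
    unfolding B_def by (simp add: cinner_simps) blast
  define P where "P x = sqrt K *\<^sub>R P0 x" for x
  have P0_lin: "bounded_clinear P0" using P0(1) by (simp add: positive_op_def)
  have P: "positive_op P"
    unfolding P_def by (rule positive_op_scaleR) (use P0 K in auto)
  have PP: "P (P x) = A x" for x
    using K by (simp add: P_def bounded_clinear_simps[OF P0_lin] P0(2) B_def)
  show ?thesis
  proof (rule ex1I)
    show "positive_op P \<and> P \<circ> P = A" using P PP by auto
    fix Q assume Q: "positive_op Q \<and> Q \<circ> Q = A"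
    then have QQ: "Q (Q x) = A x" for x by auto
    have Q_lin: "bounded_clinear Q" using Q by (simp add: positive_op_def)
    have "Q (B x) = B (Q x)" for x
      by (simp add: B_def bounded_clinear_simps[OF Q_lin] QQ[symmetric])
    then have "Q (P x) = P (Q x)" for x
      using P0(3)[OF Q_lin] by (simp add: P_def bounded_clinear_simps[OF Q_lin])
    then show "Q = P"
      using commuting_positive_sqrt_unique[of Q P] P Q QQ PP by auto
  qed
qed

section \<open>Extension from dense subspaces\<close>

text \<open>The map is given as a linear relation, so well-definedness comes out of the norm bound:
  applied to differences it yields single-valuedness and the Lipschitz property at once. Linearity
  of the continuous extension follows by taking limits.\<close>

lemma bounded_clinear_extension:
  fixes G :: "('c::complex_inner \<times> 'd::chilbert_space) set"
  assumes add: "\<And>x y x' y'. (x, y) \<in> G \<Longrightarrow> (x', y') \<in> G \<Longrightarrow> (x + x', y + y') \<in> G"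
    and scale: "\<And>c x y. (x, y) \<in> G \<Longrightarrow> (c *\<^sub>C x, c *\<^sub>C y) \<in> G"
    and bound: "\<And>x y. (x, y) \<in> G \<Longrightarrow> norm y \<le> K * norm x" and K: "0 \<le> K"
    and dense: "closure (fst ` G) = UNIV"
  obtains L where "bounded_clinear L" "\<And>x y. (x, y) \<in> G \<Longrightarrow> L x = y"
proof -
  define f where "f x = (SOME y. (x, y) \<in> G)" for x
  have f: "(x, f x) \<in> G" if "x \<in> fst ` G" for x
    using that unfolding f_def by (auto intro: someI)
  have diff: "(x - x', y - y') \<in> G" if "(x, y) \<in> G" "(x', y') \<in> G" for x y x' y'
    using add[OF that(1) scale[OF that(2), of "-1"]] by (simp add: scaleC_minus_one)
  have uniq: "y = y'" if "(x, y) \<in> G" "(x, y') \<in> G" for x y y'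
    using bound[OF diff[OF that]] by simp
  have "K-lipschitz_on (fst ` G) f"
  proof (rule lipschitz_onI[OF _ K])
    show "dist (f x) (f y) \<le> K * dist x y" if "x \<in> fst ` G" "y \<in> fst ` G" for x y
      using bound[OF diff[OF f f], OF that] by (simp add: dist_norm)
  qed
  then have "uniformly_continuous_on (fst ` G) f"
    by (rule lipschitz_on_uniformly_continuous)
  then obtain g where g: "uniformly_continuous_on UNIV g" "\<And>x. x \<in> fst ` G \<Longrightarrow> f x = g x"
    using uniformly_continuous_on_extension_on_closure[of "fst ` G" f] unfolding dense by metis
  have gG: "g x = y" if "(x, y) \<in> G" for x y
  proof -
    have x: "x \<in> fst ` G" using that by force
    show ?thesis using uniq[OF f[OF x] that] g(2)[OF x] by simp
  qed
  have cont: "(\<lambda>n. g (X n)) \<longlonglongrightarrow> g x" if "X \<longlonglongrightarrow> x" for X x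
    using uniformly_continuous_imp_continuous[OF g(1)] that
    by (auto simp: continuous_on_eq_continuous_at intro: isCont_tendsto_compose)
  have approx: "\<exists>X. (\<forall>n. (X n, g (X n)) \<in> G) \<and> X \<longlonglongrightarrow> x" for x
  proof -
    have "x \<in> closure (fst ` G)" using dense by simp
    then obtain X where X: "\<And>n. X n \<in> fst ` G" "X \<longlonglongrightarrow> x"
      unfolding closure_sequential by blast
    have "\<forall>n. (X n, g (X n)) \<in> G" using f[OF X(1)] g(2)[OF X(1)] by simp
    with X(2) show ?thesis by blast
  qed
  show ?thesis
  proof
    show "bounded_clinear g"
    proof (rule bounded_clinearI[of _ K])
      fix x y
      obtain X Y where X: "\<And>n. (X n, g (X n)) \<in> G" "X \<longlonglongrightarrow> x"
        and Y: "\<And>n. (Y n, g (Y n)) \<in> G" "Y \<longlonglongrightarrow> y"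
        using approx[of x] approx[of y] by metis
      have "(\<lambda>n. g (X n + Y n)) \<longlonglongrightarrow> g (x + y)"
        by (intro cont tendsto_add X Y)
      moreover have "g (X n + Y n) = g (X n) + g (Y n)" for n
        by (intro gG add X Y)
      ultimately show "g (x + y) = g x + g y"
        using tendsto_add[OF cont[OF X(2)] cont[OF Y(2)]] LIMSEQ_unique by auto
    next
      fix c x
      obtain X where X: "\<And>n. (X n, g (X n)) \<in> G" "X \<longlonglongrightarrow> x"
        using approx[of x] by metis
      have lin: "bounded_clinear (\<lambda>x::'c. c *\<^sub>C x)" "bounded_clinear (\<lambda>x::'d. c *\<^sub>C x)"
        using bounded_clinear_scaleC_left[OF bounded_clinear_id] by simp_all
      have "(\<lambda>n. g (c *\<^sub>C X n)) \<longlonglongrightarrow> g (c *\<^sub>C x)"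
        by (intro cont bounded_clinear_tendsto[OF lin(1)] X)
      moreover have "g (c *\<^sub>C X n) = c *\<^sub>C g (X n)" for n
        by (intro gG scale X)
      ultimately show "g (c *\<^sub>C x) = c *\<^sub>C g x"
        using bounded_clinear_tendsto[OF lin(2) cont[OF X(2)]] LIMSEQ_unique by auto
    next
      fix x
      obtain X where X: "\<And>n. (X n, g (X n)) \<in> G" "X \<longlonglongrightarrow> x"
        using approx[of x] by metis
      show "norm (g x) \<le> K * norm x"
        by (rule LIMSEQ_le[OF tendsto_norm[OF cont[OF X(2)]]
              tendsto_mult_left[OF tendsto_norm[OF X(2)]]])
          (use bound X(1) in blast)
    qed
  qed (rule gG)
qed

text \<open>If \<open>K\<^sup>2\<close> times the Gram matrix of \<open>p\<close> is that of \<open>q\<close> plus a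
  positive semidefinite matrix, itself the Gram matrix of some \<open>r\<close>, then
  \<open>p i \<mapsto> q i\<close> extends to an operator of norm at most \<open>K\<close>.\<close>

inductive_set gram_graph ::
    "('i \<Rightarrow> 'c::complex_inner) \<Rightarrow> ('i \<Rightarrow> 'd::complex_inner) \<Rightarrow>
      ('i \<Rightarrow> 'e::complex_inner) \<Rightarrow> ('c \<times> 'd \<times> 'e) set"
  for p q r where
    base: "(p i, q i, r i) \<in> gram_graph p q r"
  | add: "(x, y, z) \<in> gram_graph p q r \<Longrightarrow> (x', y', z') \<in> gram_graph p q r
      \<Longrightarrow> (x + x', y + y', z + z') \<in> gram_graph p q r"
  | scale: "(x, y, z) \<in> gram_graph p q r \<Longrightarrow> (c *\<^sub>C x, c *\<^sub>C y, c *\<^sub>C z) \<in> gram_graph p q r"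

lemma bounded_clinear_extension_gram:
  fixes p :: "'i \<Rightarrow> 'c::complex_inner" and q :: "'i \<Rightarrow> 'd::chilbert_space"
    and r :: "'i \<Rightarrow> 'e::complex_inner"
  assumes gram: "\<And>i j. of_real (K\<^sup>2) * cinner (p i) (p j) = cinner (q i) (q j) + cinner (r i) (r j)"
    and K: "0 \<le> K" and dense: "closure (complex_vector.span (range p)) = UNIV"
  obtains L where "bounded_clinear L" "\<And>i. L (p i) = q i"
proof -
  let ?H = "gram_graph p q r"
  note comm = mult.left_commute[of "complex_of_real (K\<^sup>2)"]
  \<comment> \<open>The Gram identity is extended from generators to the linear hull one argument at
    a time.\<close>
  have inv1: "of_real (K\<^sup>2) * cinner x (p j) = cinner y (q j) + cinner z (r j)"
    if "(x, y, z) \<in> ?H" for x y z j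
    using that by induction (simp_all add: gram cinner_simps distrib_left comm del: of_real_power)
  have inv2: "of_real (K\<^sup>2) * cinner x x' = cinner y y' + cinner z z'"
    if "(x, y, z) \<in> ?H" "(x', y', z') \<in> ?H" for x y z x' y' z'
    using that(2)
    by induction (simp_all add: inv1[OF that(1)] cinner_simps distrib_left comm del: of_real_power)
  \<comment> \<open>The third coordinate carries the matching linear combination of the
    \<open>r i\<close>; its squared norm is the nonnegative term dropped in the norm bound.\<close>
  define G where "G = {(x, y). \<exists>z. (x, y, z) \<in> ?H}"
  have fst_G: "fst ` G = {x. \<exists>y z. (x, y, z) \<in> ?H}"
    by (force simp: G_def)
  have "complex_vector.subspace (fst ` G)"
  proof (rule complex_vector.subspaceI)
    fix i
    have "(0, 0, 0) \<in> ?H" using gram_graph.scale[OF gram_graph.base, of 0 p i q r] by simp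
    then show "0 \<in> fst ` G" by (force simp: G_def)
  next
    show "x + y \<in> fst ` G" if "x \<in> fst ` G" "y \<in> fst ` G" for x y
      using that unfolding fst_G by (blast intro: gram_graph.add)
    show "c *\<^sub>C x \<in> fst ` G" if "x \<in> fst ` G" for c x
      using that unfolding fst_G by (blast intro: gram_graph.scale)
  qed
  moreover have "range p \<subseteq> fst ` G"
    using gram_graph.base by (force simp: G_def)
  ultimately have "closure (complex_vector.span (range p)) \<subseteq> closure (fst ` G)"
    by (intro closure_mono complex_vector.span_minimal)
  then have dense_G: "closure (fst ` G) = UNIV" using dense by blast
  have bound: "norm y \<le> K * norm x" if "(x, y) \<in> G" for x y
  proof -
    obtain z where "(x, y, z) \<in> ?H" using \<open>(x, y) \<in> G\<close> by (auto simp: G_def)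
    from inv2[OF this this] have "(K * norm x)\<^sup>2 = (norm y)\<^sup>2 + (norm z)\<^sup>2"
      unfolding cinner_self power_mult_distrib of_real_mult[symmetric] of_real_add[symmetric]
        of_real_eq_iff .
    then have "(norm y)\<^sup>2 \<le> (K * norm x)\<^sup>2"
      by (simp only: le_add_same_cancel1 zero_le_power2)
    then show ?thesis
      by (rule power2_le_imp_le[OF _ mult_nonneg_nonneg[OF K norm_ge_zero]])
  qed
  obtain L where "bounded_clinear L" "\<And>x y. (x, y) \<in> G \<Longrightarrow> L x = y"
  proof (rule bounded_clinear_extension[of G K])
    show "(x + x', y + y') \<in> G" if "(x, y) \<in> G" "(x', y') \<in> G" for x y x' y'
      using that by (auto simp: G_def intro: gram_graph.add)
    show "(c *\<^sub>C x, c *\<^sub>C y) \<in> G" if "(x, y) \<in> G" for c x y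
      using that by (auto simp: G_def intro: gram_graph.scale)
  qed (use bound K dense_G in auto)
  moreover have "(p i, q i) \<in> G" for i
    using gram_graph.base[of p i q r] by (auto simp: G_def)
  ultimately show ?thesis using that by blast
qed

section \<open>Modulus and polar decomposition\<close>

lemma abs_op_ex1:
  fixes T :: "'a::chilbert_space \<Rightarrow> 'b::chilbert_space"
  assumes T: "bounded_clinear T"
  shows "\<exists>!P. positive_op P \<and> P \<circ> P = cadjoint T \<circ> T"
proof -
  obtain k where k: "k > 0" "\<And>x. norm (T x) \<le> k * norm x"
    using bounded_clinear_bound[OF T] by metis
  note adj = cinner_cadjoint[OF T]
  have adj': "cinner (cadjoint T y) x = cinner y (T x)" for x y
    by (metis adj cinner_commute)
  have cT: "bounded_clinear (cadjoint T)" "\<And>y. norm (cadjoint T y) \<le> k * norm y"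
    using bounded_clinear_cadjoint[OF T k(2)] k(1) by auto
  show ?thesis
  proof (rule positive_sqrt_ex1[of _ "k\<^sup>2"])
    show "bounded_clinear (cadjoint T \<circ> T)" by (rule bounded_clinear_compose[OF cT(1) T])
    show "cinner ((cadjoint T \<circ> T) x) y = cinner x ((cadjoint T \<circ> T) y)" for x y
      by (simp add: adj[symmetric] adj')
    show "0 < k\<^sup>2" using k(1) by simp
    fix x
    \<comment> \<open>In the expansion of |x - w / k^2|^2 the cross term is - 2 |T x|^2 / k^2, while
      |w| \<le> k |T x| makes the quadratic term at most |T x|^2 / k^2.\<close>
    define w where "w = cadjoint T (T x)"
    have xw: "inner x w = (norm (T x))\<^sup>2"
      by (simp add: w_def inner_eq_Re_cinner adj[symmetric] cinner_self)
    have w: "(norm w)\<^sup>2 \<le> k\<^sup>2 * (norm (T x))\<^sup>2"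
      using power_mono[OF cT(2)[of "T x"], of 2] by (simp add: w_def power_mult_distrib)
    have "(norm (x - c *\<^sub>R w))\<^sup>2 = (norm x)\<^sup>2 - 2 * c * inner x w + c * c * (norm w)\<^sup>2" for c
      unfolding power2_norm_eq_inner inner_diff_left inner_diff_right inner_scaleR_left
        inner_scaleR_right inner_commute[of w x]
      by argo
    from this[of "1 / k\<^sup>2"] have "(norm (x - (1 / k\<^sup>2) *\<^sub>R w))\<^sup>2
        = (norm x)\<^sup>2 - 2 / k\<^sup>2 * (norm (T x))\<^sup>2 + (norm w)\<^sup>2 / (k\<^sup>2 * k\<^sup>2)"
      by (simp add: xw)
    also have "\<dots> \<le> (norm x)\<^sup>2 - 2 / k\<^sup>2 * (norm (T x))\<^sup>2 + k\<^sup>2 * (norm (T x))\<^sup>2 / (k\<^sup>2 * k\<^sup>2)"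
      using w by (intro add_left_mono divide_right_mono) auto
    also have "\<dots> = (norm x)\<^sup>2 - (norm (T x))\<^sup>2 / k\<^sup>2"
      using k(1) by (simp add: field_simps)
    also have "\<dots> \<le> (norm x)\<^sup>2" by simp
    finally show "norm (x - (1 / k\<^sup>2) *\<^sub>R (cadjoint T \<circ> T) x) \<le> norm x"
      unfolding w_def o_def by (rule power2_le_imp_le) simp
  qed
qed

lemma abs_op_eqI:
  fixes T :: "'a::chilbert_space \<Rightarrow> 'b::chilbert_space"
  assumes "bounded_clinear T" "positive_op P" "P \<circ> P = cadjoint T \<circ> T"
  shows "abs_op T = P"
  unfolding abs_op_def sqrt_op_def
  by (rule the1_equality[OF abs_op_ex1]) (use assms in auto)

context
  fixes T :: "'a::chilbert_space \<Rightarrow> 'b::chilbert_space"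
  assumes T: "bounded_clinear T"
begin

lemma positive_abs_op: "positive_op (abs_op T)"
  and abs_op_square: "abs_op T \<circ> abs_op T = cadjoint T \<circ> T"
  using theI'[OF abs_op_ex1[OF T]] unfolding abs_op_def sqrt_op_def by simp_all

lemma bounded_clinear_abs_op: "bounded_clinear (abs_op T)"
  using positive_abs_op by (simp add: positive_op_def)

lemma norm_abs_op: "norm (abs_op T x) = norm (T x)"
proof (rule norm_eq_of_cinner_eq)
  have "cinner (abs_op T x) (abs_op T x) = cinner x ((abs_op T \<circ> abs_op T) x)"
    by (simp add: positive_op_self_adjoint[OF positive_abs_op])
  also have "\<dots> = cinner (T x) (T x)"
    by (simp only: abs_op_square) (simp add: cinner_cadjoint[OF T])
  finally show "cinner (abs_op T x) (abs_op T x) = cinner (T x) (T x)" .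
qed

text \<open>A vector orthogonal to the range of |T| satisfies |T| x = 0, so it lies in the kernel of
  T and is orthogonal to itself. A bounded operator is therefore determined by its values on range
  and kernel, which drives the polar decomposition.\<close>

lemma abs_op_plus_kernel_dense:
  "closure {abs_op T x + n | x n. T n = 0} = UNIV"
proof (rule dense_of_zero_complement)
  note simps = bounded_clinear_simps[OF bounded_clinear_abs_op] bounded_clinear_simps[OF T]
  show "subspace {abs_op T x + n | x n. T n = 0}"
  proof (rule subspaceI)
    show "0 \<in> {abs_op T x + n | x n. T n = 0}"
      using simps by (auto intro!: exI[of _ 0])
  next
    fix u v assume "u \<in> {abs_op T x + n | x n. T n = 0}" "v \<in> {abs_op T x + n | x n. T n = 0}"
    then obtain x n y m where "u = abs_op T x + n" "v = abs_op T y + m" "T n = 0" "T m = 0"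
      by blast
    then have "u + v = abs_op T (x + y) + (n + m)" "T (n + m) = 0"
      by (simp_all add: simps)
    then show "u + v \<in> {abs_op T x + n | x n. T n = 0}" by blast
  next
    fix c u assume "u \<in> {abs_op T x + n | x n. T n = 0}"
    then obtain x n where "u = abs_op T x + n" "T n = 0" by blast
    then have "c *\<^sub>R u = abs_op T (c *\<^sub>R x) + c *\<^sub>R n" "T (c *\<^sub>R n) = 0"
      by (simp_all add: simps scaleR_add_right)
    then show "c *\<^sub>R u \<in> {abs_op T x + n | x n. T n = 0}" by blast
  qed
  fix x assume orth: "\<And>m. m \<in> {abs_op T x + n | x n. T n = 0} \<Longrightarrow> inner x m = 0"
  have "inner (abs_op T x) (abs_op T x) = inner x (abs_op T (abs_op T x) + 0)"
    by (simp add: inner_eq_Re_cinner positive_op_self_adjoint[OF positive_abs_op])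
  also have "\<dots> = 0"
    by (rule orth) (use simps in blast)
  finally have "T x = 0" using norm_abs_op[of x] by simp
  then have "abs_op T 0 + x \<in> {abs_op T x + n | x n. T n = 0}" by blast
  from orth[OF this] show "x = 0" by (simp add: simps)
qed

text \<open>V is prescribed by |T| x + n |-> T x for n in the kernel of T. The summands are
  orthogonal and |T| x has the norm of T x, so the prescription is bounded by 1 and extends.\<close>

lemma polar_ex1:
  "\<exists>!V. partial_isometry V \<and> op_kernel V = op_kernel T \<and> T = V \<circ> abs_op T"
proof -
  note P_simps = bounded_clinear_simps[OF bounded_clinear_abs_op]
  note T_simps = bounded_clinear_simps[OF T]
  have orth: "cinner (abs_op T x) n = 0" if "T n = 0" for x n
    using norm_abs_op[of n] that
    by (simp add: positive_op_self_adjoint[OF positive_abs_op])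
  have approx: "\<exists>X N. (\<forall>k. T (N k) = 0) \<and> (\<lambda>k. abs_op T (X k) + N k) \<longlonglongrightarrow> x" for x
  proof -
    have "x \<in> closure {abs_op T x + n | x n. T n = 0}"
      using abs_op_plus_kernel_dense by simp
    then obtain Z where Z: "\<And>k. Z k \<in> {abs_op T x + n | x n. T n = 0}" "Z \<longlonglongrightarrow> x"
      unfolding closure_sequential by blast
    have "\<forall>k. \<exists>x n. Z k = abs_op T x + n \<and> T n = 0" using Z(1) by blast
    then obtain X N where XN: "\<And>k. Z k = abs_op T (X k) + N k" "\<And>k. T (N k) = 0"
      by metis
    have "Z = (\<lambda>k. abs_op T (X k) + N k)" using XN(1) by blast
    with Z(2) XN(2) show ?thesis by blast
  qed
  \<comment> \<open>Any admissible V is computed as the limit of T along approximants of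
    \<open>x\<close>; this serves both the properties of V and its uniqueness.\<close>
  have cont: "(\<lambda>k. T (X k)) \<longlonglongrightarrow> V x"
    if V: "bounded_clinear V" "\<And>x. V (abs_op T x) = T x" "\<forall>n. T n = 0 \<longrightarrow> V n = 0"
      and X: "\<And>k. T (N k) = 0" "(\<lambda>k. abs_op T (X k) + N k) \<longlonglongrightarrow> x" for V x X N
    using bounded_clinear_tendsto[OF V(1) X(2)]
    by (simp add: bounded_clinear_simps[OF V(1)] V(2) V(3)[rule_format] X(1))
  define G where "G = {(abs_op T x + n, T x) | x n. T n = 0}"
  obtain V where V: "bounded_clinear V" "\<And>x y. (x, y) \<in> G \<Longrightarrow> V x = y"
  proof (rule bounded_clinear_extension[of G 1])
    fix x y x' y' assume "(x, y) \<in> G" "(x', y') \<in> G"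
    then obtain u n u' n' where "x = abs_op T u + n" "y = T u" "T n = 0"
      "x' = abs_op T u' + n'" "y' = T u'" "T n' = 0"
      by (auto simp: G_def)
    then have "x + x' = abs_op T (u + u') + (n + n')" "y + y' = T (u + u')" "T (n + n') = 0"
      by (simp_all add: P_simps T_simps)
    then show "(x + x', y + y') \<in> G" unfolding G_def by blast
  next
    fix c x y assume "(x, y) \<in> G"
    then obtain u n where "x = abs_op T u + n" "y = T u" "T n = 0"
      by (auto simp: G_def)
    then have "c *\<^sub>C x = abs_op T (c *\<^sub>C u) + c *\<^sub>C n" "c *\<^sub>C y = T (c *\<^sub>C u)" "T (c *\<^sub>C n) = 0"
      by (simp_all add: P_simps T_simps scaleC_add_right)
    then show "(c *\<^sub>C x, c *\<^sub>C y) \<in> G" unfolding G_def by blast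
  next
    fix x y assume "(x, y) \<in> G"
    then obtain u n where un: "x = abs_op T u + n" "y = T u" "T n = 0"
      by (auto simp: G_def)
    have "inner (abs_op T u) n = 0" using orth[OF un(3)] by (simp add: inner_eq_Re_cinner)
    then have "(norm x)\<^sup>2 = (norm y)\<^sup>2 + (norm n)\<^sup>2"
      using norm_abs_op[of u]
      by (simp add: un power2_norm_eq_inner inner_add_left inner_add_right inner_commute norm_eq)
    then have "(norm y)\<^sup>2 \<le> (norm x)\<^sup>2" by simp
    from power2_le_imp_le[OF this norm_ge_zero] show "norm y \<le> 1 * norm x" by simp
  next
    have "fst ` G = {abs_op T x + n | x n. T n = 0}"
      unfolding G_def by force
    then show "closure (fst ` G) = UNIV" using abs_op_plus_kernel_dense by simp
  qed auto
  have V_abs: "V (abs_op T x) = T x" for x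
  proof -
    have "(abs_op T x + 0, T x) \<in> G" unfolding G_def using T_simps(3) by blast
    from V(2)[OF this] show ?thesis by simp
  qed
  have V_ker: "\<forall>n. T n = 0 \<longrightarrow> V n = 0"
  proof (intro allI impI)
    fix n assume "T n = 0"
    then have "(abs_op T 0 + n, T 0) \<in> G" unfolding G_def by blast
    from V(2)[OF this] show "V n = 0" by (simp add: P_simps T_simps)
  qed
  note V_cont = cont[OF V(1) V_abs V_ker]
  \<comment> \<open>If V x = 0, the range parts of the approximants tend to 0, so \<open>x\<close>
    is a limit of kernel vectors.\<close>
  have ker: "T x = 0" if "V x = 0" for x
  proof -
    obtain X N where X: "\<And>k. T (N k) = 0" "(\<lambda>k. abs_op T (X k) + N k) \<longlonglongrightarrow> x"
      using approx[of x] by blast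
    have "(\<lambda>k. T (X k)) \<longlonglongrightarrow> 0" using V_cont[OF X] that by simp
    then have "(\<lambda>k. abs_op T (X k)) \<longlonglongrightarrow> 0"
      by (subst tendsto_norm_zero_iff[symmetric]) (simp add: norm_abs_op tendsto_norm_zero_iff)
    from tendsto_diff[OF X(2) this] have "N \<longlonglongrightarrow> x" by simp
    from bounded_clinear_tendsto[OF T this] show ?thesis
      by (simp add: X(1) LIMSEQ_const_iff)
  qed
  \<comment> \<open>For \<open>x\<close> orthogonal to the kernel, |N k|^2 = <Z k - x, N k>, so the
    kernel parts of the approximants tend to 0.\<close>
  have iso: "norm (V x) = norm x" if x: "\<And>n. T n = 0 \<Longrightarrow> cinner x n = 0" for x
  proof -
    obtain X N where X: "\<And>k. T (N k) = 0" "(\<lambda>k. abs_op T (X k) + N k) \<longlonglongrightarrow> x"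
      using approx[of x] by blast
    define Z where "Z k = abs_op T (X k) + N k" for k
    have Z: "(\<lambda>k. norm (Z k - x)) \<longlonglongrightarrow> 0"
      using X(2) unfolding Z_def by (simp add: LIM_zero_iff tendsto_norm_zero)
    have "norm (N k) \<le> norm (Z k - x)" for k
    proof (cases "N k = 0")
      case False
      have "cinner (Z k - x) (N k) = of_real ((norm (N k))\<^sup>2)"
        by (simp add: Z_def cinner_simps orth[OF X(1)] x[OF X(1)] cinner_self)
      then have "(norm (N k))\<^sup>2 = cmod (cinner (Z k - x) (N k))"
        by (simp add: norm_power)
      also have "\<dots> \<le> norm (Z k - x) * norm (N k)" by (rule norm_cinner)
      finally show ?thesis using False by (simp add: power2_eq_square)
    qed simp
    then have "N \<longlonglongrightarrow> 0"
      by (intro Lim_null_comparison[OF _ Z]) simp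
    from tendsto_diff[OF X(2) this] have "(\<lambda>k. abs_op T (X k)) \<longlonglongrightarrow> x" by simp
    from tendsto_norm[OF this] have "(\<lambda>k. norm (T (X k))) \<longlonglongrightarrow> norm x"
      by (simp add: norm_abs_op)
    with tendsto_norm[OF V_cont[OF X]] show ?thesis using LIMSEQ_unique by blast
  qed
  have ker_eq: "op_kernel V = op_kernel T"
    using V_ker ker by (auto simp: op_kernel_def)
  show ?thesis
  proof (rule ex1I)
    show "partial_isometry V \<and> op_kernel V = op_kernel T \<and> T = V \<circ> abs_op T"
      using V(1) iso V_abs ker_eq by (auto simp: partial_isometry_def op_kernel_def)
    fix V' assume V': "partial_isometry V' \<and> op_kernel V' = op_kernel T \<and> T = V' \<circ> abs_op T"
    have V'_lin: "bounded_clinear V'" using V' by (simp add: partial_isometry_def)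
    have V'_abs: "V' (abs_op T x) = T x" for x using V' by (metis comp_apply)
    have V'_ker: "\<forall>n. T n = 0 \<longrightarrow> V' n = 0" using V' by (auto simp: op_kernel_def)
    show "V' = V"
    proof
      fix x
      obtain X N where X: "\<And>k. T (N k) = 0" "(\<lambda>k. abs_op T (X k) + N k) \<longlonglongrightarrow> x"
        using approx[of x] by blast
      show "V' x = V x"
        using V_cont[OF X] cont[OF V'_lin V'_abs V'_ker X] LIMSEQ_unique by blast
    qed
  qed
qed

lemma partial_isometry_polar_isometry: "partial_isometry (polar_isometry T)"
  and op_kernel_polar_isometry: "op_kernel (polar_isometry T) = op_kernel T"
  and polar_decomposition: "T = polar_isometry T \<circ> abs_op T"
  using theI'[OF polar_ex1] unfolding polar_isometry_def by blast+

lemma polar_isometry_eqI: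
  "partial_isometry V \<Longrightarrow> op_kernel V = op_kernel T \<Longrightarrow> T = V \<circ> abs_op T \<Longrightarrow> polar_isometry T = V"
  unfolding polar_isometry_def by (rule the1_equality[OF polar_ex1]) auto

end

section \<open>Unitary equivalence\<close>

text \<open>A unitary between possibly different spaces, with its inverse as an explicit parameter.
  It covers both a unitary U on one space and the flip between two tensor products.\<close>

locale hilbert_isomorphism =
  fixes W :: "'c::chilbert_space \<Rightarrow> 'd::chilbert_space" and W' :: "'d \<Rightarrow> 'c"
  assumes W: "bounded_clinear W" and W': "bounded_clinear W'"
    and left_inverse [simp]: "W' (W x) = x" and right_inverse [simp]: "W (W' y) = y"
    and cinner_W: "cinner (W x) (W x') = cinner x x'"
begin

lemma inverse_isomorphism: "hilbert_isomorphism W' W"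
  by unfold_locales (simp_all add: W W', metis cinner_W right_inverse)

lemma norm_W: "norm (W x) = norm x"
  by (rule norm_eq_of_cinner_eq) (rule cinner_W)

lemma cinner_W_left: "cinner (W x) y = cinner x (W' y)"
  by (metis cinner_W right_inverse)

lemma cinner_W'_left: "cinner (W' y) x = cinner y (W x)"
  by (metis cinner_W right_inverse)

lemma W_eq_0_iff: "W x = 0 \<longleftrightarrow> x = 0"
  by (metis norm_W norm_eq_zero)

lemma image_W: "W ` {x. P x} = {y. P (W' y)}"
  by (force simp: image_iff)

lemma bounded_clinear_conj: "bounded_clinear A \<Longrightarrow> bounded_clinear (W \<circ> A \<circ> W')"
  by (intro bounded_clinear_compose W W')

lemma cadjoint_conj:
  assumes "bounded_clinear A"
  shows "cadjoint (W \<circ> A \<circ> W') = W \<circ> cadjoint A \<circ> W'"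
  by (rule cadjointI) (simp add: cinner_W_left cinner_cadjoint[OF assms] cinner_W'_left)

lemma positive_op_conj: "positive_op P \<Longrightarrow> positive_op (W \<circ> P \<circ> W')"
  unfolding positive_op_def by (metis bounded_clinear_conj cinner_W_left comp_apply)

lemma abs_op_conj:
  assumes A: "bounded_clinear A"
  shows "abs_op (W \<circ> A \<circ> W') = W \<circ> abs_op A \<circ> W'"
proof (rule abs_op_eqI)
  show "(W \<circ> abs_op A \<circ> W') \<circ> (W \<circ> abs_op A \<circ> W') = cadjoint (W \<circ> A \<circ> W') \<circ> (W \<circ> A \<circ> W')"
    using fun_cong[OF abs_op_square[OF A]] by (simp add: cadjoint_conj[OF A] fun_eq_iff)
qed (intro bounded_clinear_conj positive_op_conj positive_abs_op A)+

lemma polar_isometry_conj: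
  assumes A: "bounded_clinear A"
  shows "polar_isometry (W \<circ> A \<circ> W') = W \<circ> polar_isometry A \<circ> W'"
proof (rule polar_isometry_eqI[OF bounded_clinear_conj[OF A]])
  let ?V = "polar_isometry A"
  have V: "bounded_clinear ?V"
    "norm (?V x) = norm x" if "\<And>z. z \<in> op_kernel ?V \<Longrightarrow> cinner x z = 0" for x
    using partial_isometry_polar_isometry[OF A] that by (auto simp: partial_isometry_def)
  show "partial_isometry (W \<circ> ?V \<circ> W')"
    unfolding partial_isometry_def
  proof (intro conjI allI impI)
    show "bounded_clinear (W \<circ> ?V \<circ> W')"
      using partial_isometry_polar_isometry[OF A]
      by (intro bounded_clinear_conj) (simp add: partial_isometry_def)
    fix y assume y: "\<forall>z\<in>op_kernel (W \<circ> ?V \<circ> W'). cinner y z = 0"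
    have "norm (?V (W' y)) = norm (W' y)"
    proof (rule V(2))
      fix z assume "z \<in> op_kernel ?V"
      then have "W z \<in> op_kernel (W \<circ> ?V \<circ> W')" by (simp add: op_kernel_def W_eq_0_iff)
      with y show "cinner (W' y) z = 0" by (simp add: cinner_W'_left)
    qed
    then show "norm ((W \<circ> ?V \<circ> W') y) = norm y" by (metis comp_apply norm_W right_inverse)
  qed
  show "op_kernel (W \<circ> ?V \<circ> W') = op_kernel (W \<circ> A \<circ> W')"
    using op_kernel_polar_isometry[OF A] by (auto simp: op_kernel_def W_eq_0_iff set_eq_iff)
  show "W \<circ> A \<circ> W' = W \<circ> ?V \<circ> W' \<circ> abs_op (W \<circ> A \<circ> W')"
    using fun_cong[OF polar_decomposition[OF A]] by (simp add: abs_op_conj[OF A] fun_eq_iff)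
qed

lemma mean_transform_conj:
  assumes A: "bounded_clinear A"
  shows "mean_transform l (W \<circ> A \<circ> W') = W \<circ> mean_transform l A \<circ> W'"
  by (simp add: mean_transform_def duggal_transform_def abs_op_conj[OF A] polar_isometry_conj[OF A]
      fun_eq_iff bounded_clinear_simps[OF W])

section \<open>Unitary invariance of spectrum, numerical radius and norm\<close>

lemma cspectrum_conj_subset: "cspectrum (W \<circ> A \<circ> W') \<subseteq> cspectrum A"
proof -
  have "z \<notin> cspectrum (W \<circ> A \<circ> W')" if z: "z \<notin> cspectrum A" for z
  proof -
    obtain B where B: "bounded_clinear B" "\<And>x. B (A x - z *\<^sub>C x) = x" "\<And>x. A (B x) - z *\<^sub>C B x = x"
      using z by (auto simp: cspectrum_def fun_eq_iff)
    have shift: "W (A (W' y)) - z *\<^sub>C y = W (A (W' y) - z *\<^sub>C W' y)" for y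
      by (simp add: bounded_clinear_simps[OF W])
    have "bounded_clinear (W \<circ> B \<circ> W')" using B(1) by (rule bounded_clinear_conj)
    moreover have "(W \<circ> B \<circ> W') \<circ> (\<lambda>y. (W \<circ> A \<circ> W') y - z *\<^sub>C y) = id"
      by (simp add: fun_eq_iff shift B)
    moreover have "(\<lambda>y. (W \<circ> A \<circ> W') y - z *\<^sub>C y) \<circ> (W \<circ> B \<circ> W') = id"
      by (simp add: fun_eq_iff shift B)
    ultimately show ?thesis unfolding cspectrum_def by blast
  qed
  then show ?thesis by blast
qed

lemma cspectrum_conj: "cspectrum (W \<circ> A \<circ> W') = cspectrum A"
proof
  have "W' \<circ> (W \<circ> A \<circ> W') \<circ> W = A" by (simp add: fun_eq_iff)
  then show "cspectrum A \<subseteq> cspectrum (W \<circ> A \<circ> W')"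
    using hilbert_isomorphism.cspectrum_conj_subset[OF inverse_isomorphism, of "W \<circ> A \<circ> W'"] by simp
qed (rule cspectrum_conj_subset)

lemma spectral_radius_conj: "spectral_radius (W \<circ> A \<circ> W') = spectral_radius A"
  by (simp add: spectral_radius_def cspectrum_conj)

text \<open>Reindexing by \<open>W\<close> makes the two sets of values literally equal, so the
  equality includes the zero space, where both sides are \<open>Sup {}\<close>.\<close>

lemma numerical_radius_conj: "numerical_radius (W \<circ> A \<circ> W') = numerical_radius A"
proof -
  have "{y. norm y = 1} = W ` {x. norm x = 1}"
    unfolding image_W by (metis norm_W right_inverse)
  then show ?thesis
    by (simp add: numerical_radius_def image_image cinner_W)
qed

lemma onorm_conj: "onorm (W \<circ> A \<circ> W') = onorm A"
proof -
  have "UNIV = range W" by (metis right_inverse surjI)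
  then have "onorm (W \<circ> A \<circ> W') = (SUP y\<in>range W. norm ((W \<circ> A \<circ> W') y) / norm y)"
    by (simp add: onorm_def)
  also have "\<dots> = onorm A"
    by (simp add: onorm_def image_image norm_W)
  finally show ?thesis .
qed

end

lemma hilbert_isomorphism_unitary:
  assumes "unitary_op U"
  shows "hilbert_isomorphism U (cadjoint U)"
proof
  show U: "bounded_clinear U" using assms by (simp add: unitary_op_def)
  then obtain K where "K > 0" "\<And>x. norm (U x) \<le> K * norm x"
    using bounded_clinear_bound by blast
  with U show "bounded_clinear (cadjoint U)" by (intro bounded_clinear_cadjoint) auto
  show inv: "cadjoint U (U x) = x" for x
    using assms by (metis unitary_op_def comp_apply id_apply)
  show "U (cadjoint U y) = y" for y
    using assms by (metis unitary_op_def comp_apply id_apply)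
  show "cinner (U x) (U x') = cinner x x'" for x x'
    by (simp add: cinner_cadjoint[OF U] inv)
qed

section \<open>Homogeneity\<close>

text \<open>The case c = 0 of homogeneity. The modulus is the outer factor of the Duggal transform,
  so |0| = 0 annihilates it whatever the partial isometry.\<close>

lemma mean_transform_zero: "mean_transform l (\<lambda>x::'a::chilbert_space. 0) = (\<lambda>x. 0)"
proof -
  have zero: "bounded_clinear (\<lambda>x::'a. 0::'a)"
    by (rule bounded_clinearI[of _ 0]) auto
  have "abs_op (\<lambda>x::'a. 0::'a) = (\<lambda>x. 0)"
  proof (rule abs_op_eqI[OF zero])
    show "positive_op (\<lambda>x::'a. 0::'a)" by (simp add: positive_op_def zero)
    have "cadjoint (\<lambda>x::'a. 0::'a) = (\<lambda>x. 0)" by (rule cadjointI) simp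
    then show "(\<lambda>x::'a. 0::'a) \<circ> (\<lambda>x. 0) = cadjoint (\<lambda>x::'a. 0::'a) \<circ> (\<lambda>x. 0)" by auto
  qed
  then show ?thesis by (simp add: mean_transform_def duggal_transform_def)
qed

context
  fixes S :: "'a::chilbert_space \<Rightarrow> 'a" and c :: complex
  assumes S: "bounded_clinear S"
begin

text \<open>The phase of \<open>c\<close> cancels against the conjugate coming from the adjoint,
  leaving |c|^2 under the square root.\<close>

lemma abs_op_scaleC: "abs_op (\<lambda>x. c *\<^sub>C S x) = (\<lambda>x. cmod c *\<^sub>R abs_op S x)"
proof (rule abs_op_eqI)
  show "positive_op (\<lambda>x. cmod c *\<^sub>R abs_op S x)"
    by (intro positive_op_scaleR positive_abs_op S) simp
  have "cadjoint (\<lambda>x. c *\<^sub>C S x) = (\<lambda>y. cnj c *\<^sub>C cadjoint S y)"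
    by (rule cadjointI) (simp add: cinner_simps cinner_cadjoint[OF S])
  moreover obtain K where "K > 0" "\<And>x. norm (S x) \<le> K * norm x"
    using bounded_clinear_bound[OF S] by blast
  then have "bounded_clinear (cadjoint S)"
    using S by (intro bounded_clinear_cadjoint) auto
  ultimately show "(\<lambda>x. cmod c *\<^sub>R abs_op S x) \<circ> (\<lambda>x. cmod c *\<^sub>R abs_op S x)
      = cadjoint (\<lambda>x. c *\<^sub>C S x) \<circ> (\<lambda>x. c *\<^sub>C S x)"
    using fun_cong[OF abs_op_square[OF S]]
    by (simp add: fun_eq_iff bounded_clinear_simps bounded_clinear_abs_op[OF S] scaleC_scaleC
        scaleR_scaleC complex_norm_square[symmetric] power2_eq_square mult.commute[of "cnj c"])
qed (rule bounded_clinear_scaleC_left[OF S])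

text \<open>The phase \<open>sgn c\<close> is unimodular, so it preserves norms and kernels;
  multiplied by the factor |c| of the modulus it restores \<open>c\<close>.\<close>

lemma polar_isometry_scaleC:
  assumes c: "c \<noteq> 0"
  shows "polar_isometry (\<lambda>x. c *\<^sub>C S x) = (\<lambda>x. sgn c *\<^sub>C polar_isometry S x)"
proof (rule polar_isometry_eqI[OF bounded_clinear_scaleC_left[OF S]])
  let ?V = "polar_isometry S"
  have V: "bounded_clinear ?V"
    using partial_isometry_polar_isometry[OF S] by (simp add: partial_isometry_def)
  have ker: "op_kernel (\<lambda>x. d *\<^sub>C A x) = op_kernel A" if "d \<noteq> 0" for d and A :: "'a \<Rightarrow> 'a"
    using that by (simp add: op_kernel_def)
  have sgn: "sgn c \<noteq> 0" "cmod (sgn c) = 1" using c by (simp_all add: sgn_zero_iff norm_sgn)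
  show "partial_isometry (\<lambda>x. sgn c *\<^sub>C ?V x)"
    using partial_isometry_polar_isometry[OF S] bounded_clinear_scaleC_left[OF V]
    by (simp add: partial_isometry_def ker sgn norm_scaleC)
  show "op_kernel (\<lambda>x. sgn c *\<^sub>C ?V x) = op_kernel (\<lambda>x. c *\<^sub>C S x)"
    using c sgn by (simp add: ker op_kernel_polar_isometry[OF S])
  have "sgn c * complex_of_real (cmod c) = c" using c by (simp add: sgn_eq)
  then show "(\<lambda>x. c *\<^sub>C S x) = (\<lambda>x. sgn c *\<^sub>C ?V x) \<circ> abs_op (\<lambda>x. c *\<^sub>C S x)"
    using fun_cong[OF polar_decomposition[OF S], symmetric]
    by (simp add: abs_op_scaleC fun_eq_iff bounded_clinear_simps[OF V] scaleR_scaleC scaleC_scaleC)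
qed

lemma mean_transform_scaleC:
  "mean_transform l (\<lambda>x. c *\<^sub>C S x) = (\<lambda>x. c *\<^sub>C mean_transform l S x)"
proof (cases "c = 0")
  case True
  then show ?thesis by (simp add: mean_transform_zero)
next
  case False
  then have "complex_of_real (cmod c) * sgn c = c" by (simp add: sgn_eq)
  then show ?thesis
    by (simp add: mean_transform_def duggal_transform_def abs_op_scaleC
        polar_isometry_scaleC[OF False] fun_eq_iff bounded_clinear_simps[OF bounded_clinear_abs_op[OF S]]
        scaleC_add_right scaleR_scaleC scaleC_scaleC mult_ac)
qed

end

section \<open>Tensor products\<close>

text \<open>Such a property cuts out a closed subspace containing the elementary tensors, whose span
  is dense.\<close>

lemma hilbert_tensor_induct:
  assumes t: "hilbert_tensor t" and closed: "closed {z. P z}"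
    and elementary: "\<And>x y. P (t x y)"
    and add: "\<And>z w. P z \<Longrightarrow> P w \<Longrightarrow> P (z + w)" and scale: "\<And>c z. P z \<Longrightarrow> P (c *\<^sub>C z)"
  shows "P z"
proof -
  have "P 0" using scale[of "t 0 0" 0] elementary by simp
  then have "complex_vector.subspace {z. P z}"
    using add scale by (simp add: complex_vector.subspace_def)
  then have "closure (complex_vector.span {t x y | x y. True}) \<subseteq> {z. P z}"
    using elementary by (intro closure_minimal closed complex_vector.span_minimal) auto
  then show ?thesis using t by (auto simp: hilbert_tensor_def)
qed

lemma bounded_clinear_continuous: "bounded_clinear T \<Longrightarrow> continuous_on UNIV T"
  using bounded_clinear_bounded_linear linear_continuous_on by blast

lemma hilbert_tensor_ext:
  assumes t: "hilbert_tensor t" and A: "bounded_clinear A" and B: "bounded_clinear B"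
    and eq: "\<And>x y. A (t x y) = B (t x y)"
  shows "A = B"
proof
  fix z show "A z = B z"
    by (rule hilbert_tensor_induct[OF t, where P = "\<lambda>z. A z = B z"])
      (auto simp: eq bounded_clinear_simps[OF A] bounded_clinear_simps[OF B]
        intro!: closed_Collect_eq bounded_clinear_continuous A B)
qed

text \<open>Boundedness of t x y |-> q x y is certified by exhibiting the excess of the scaled Gram
  matrix as the Gram matrix of \<open>r\<close>; isometric maps take K = 1 and r = 0.\<close>

lemma hilbert_tensor_extension:
  fixes t :: "'a::chilbert_space \<Rightarrow> 'b::chilbert_space \<Rightarrow> 'c::chilbert_space"
    and q :: "'a \<Rightarrow> 'b \<Rightarrow> 'd::chilbert_space" and r :: "'a \<Rightarrow> 'b \<Rightarrow> 'e::complex_inner"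
  assumes t: "hilbert_tensor t" and K: "0 \<le> K"
    and gram: "\<And>x y x' y'. of_real (K\<^sup>2) * (cinner x x' * cinner y y') =
      cinner (q x y) (q x' y') + cinner (r x y) (r x' y')"
  obtains L where "bounded_clinear L" "\<And>x y. L (t x y) = q x y"
proof -
  have "range (case_prod t) = {t x y | x y. True}" by auto
  then have "closure (complex_vector.span (range (case_prod t))) = UNIV"
    using t by (simp add: hilbert_tensor_def)
  moreover have "of_real (K\<^sup>2) * cinner (case_prod t i) (case_prod t j) =
      cinner (case_prod q i) (case_prod q j) + cinner (case_prod r i) (case_prod r j)" for i j
    using t gram by (auto simp: hilbert_tensor_def split: prod.split)
  ultimately obtain L where "bounded_clinear L" "\<And>i. L (case_prod t i) = case_prod q i"
    using bounded_clinear_extension_gram[of K "case_prod t" "case_prod q" "case_prod r"] K by blast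
  then show ?thesis using that by (metis case_prod_conv)
qed

text \<open>Q is the defect operator, the positive root of k^2 minus
  \<open>cadjoint S \<circ> S\<close>. It supplies the remainder vectors when S acts on one tensor
  factor.\<close>

lemma contraction_defect:
  fixes S :: "'a::chilbert_space \<Rightarrow> 'a"
  assumes S: "bounded_clinear S"
  obtains K Q where "0 \<le> K"
    "\<And>x y. of_real (K\<^sup>2) * cinner x y = cinner (S x) (S y) + cinner (Q x) (Q y :: 'a)"
proof -
  obtain k where k: "k > 0" "\<And>x. norm (S x) \<le> k * norm x"
    using bounded_clinear_bound[OF S] by metis
  note adj = cinner_cadjoint[OF S]
  have adj': "cinner (cadjoint S y) x = cinner y (S x)" for x y
    by (metis adj cinner_commute)
  have cS: "bounded_clinear (cadjoint S)" "\<And>y. norm (cadjoint S y) \<le> k * norm y"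
    using bounded_clinear_cadjoint[OF S k(2)] k(1) by auto
  define A where "A x = k\<^sup>2 *\<^sub>R x - cadjoint S (S x)" for x
  have "\<exists>!Q. positive_op Q \<and> Q \<circ> Q = A"
  proof (rule positive_sqrt_ex1[of _ "k\<^sup>2"])
    show "bounded_clinear A"
      unfolding A_def
      using bounded_clinear_minus[OF bounded_clinear_scaleR_left[OF bounded_clinear_id]
          bounded_clinear_compose[OF cS(1) S]] by simp
    show "cinner (A x) y = cinner x (A y)" for x y
      by (simp add: A_def cinner_simps adj' adj[symmetric])
    show "0 < k\<^sup>2" using k(1) by simp
    \<comment> \<open>Here 1 - A / k^2 is \<open>cadjoint S \<circ> S\<close> divided by k^2, and
      the latter product has bound k^2.\<close>
    show "norm (x - (1 / k\<^sup>2) *\<^sub>R A x) \<le> norm x" for x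
    proof -
      have "x - (1 / k\<^sup>2) *\<^sub>R A x = (1 / k\<^sup>2) *\<^sub>R cadjoint S (S x)"
        using k(1) by (simp add: A_def scaleR_diff_right)
      then have "norm (x - (1 / k\<^sup>2) *\<^sub>R A x) = norm (cadjoint S (S x)) / k\<^sup>2"
        by simp
      moreover have "norm (cadjoint S (S x)) \<le> k * (k * norm x)"
        using cS(2)[of "S x"] mult_left_mono[OF k(2)[of x], of k] k(1) by linarith
      ultimately show ?thesis
        using k(1) by (simp only:) (simp add: divide_le_eq power2_eq_square mult_ac)
    qed
  qed
  then obtain Q where Q: "positive_op Q" "Q \<circ> Q = A" by blast
  have "of_real (k\<^sup>2) * cinner x y = cinner (S x) (S y) + cinner (Q x) (Q y)" for x y
  proof -
    have "cinner (Q x) (Q y) = cinner (A x) y"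
      using Q(2) positive_op_self_adjoint[OF Q(1), of "Q x" y] by (metis comp_apply)
    then show ?thesis by (simp add: A_def cinner_simps adj')
  qed
  with k(1) show ?thesis using that[of k Q] by simp
qed

text \<open>The factors are treated singly, A \<otimes> B = (A \<otimes> 1)(1 \<otimes> B), so that
  each Gram identity involves one defect operator only.\<close>

lemma tensor_op_ex1:
  fixes A :: "'a::chilbert_space \<Rightarrow> 'a" and B :: "'b::chilbert_space \<Rightarrow> 'b"
  assumes t: "hilbert_tensor t" and A: "bounded_clinear A" and B: "bounded_clinear B"
  shows "\<exists>!W. bounded_clinear W \<and> (\<forall>x y. W (t x y) = t (A x) (B y))"
proof -
  have cinner_t: "cinner (t x y) (t x' y') = cinner x x' * cinner y y'" for x y x' y'
    using t by (simp add: hilbert_tensor_def)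
  obtain L where L: "bounded_clinear L" "\<And>x y. L (t x y) = t (A x) y"
  proof -
    obtain K Q where K: "0 \<le> K"
      "\<And>x y. of_real (K\<^sup>2) * cinner x y = cinner (A x) (A y) + cinner (Q x) (Q y :: 'a)"
      using contraction_defect[OF A] by blast
    have "of_real (K\<^sup>2) * (cinner x x' * cinner y y')
        = cinner (t (A x) y) (t (A x') y') + cinner (t (Q x) y) (t (Q x') y')" for x y x' y'
      unfolding cinner_t mult.assoc[symmetric] K(2) by (simp add: distrib_right)
    from hilbert_tensor_extension[OF t K(1) this] show ?thesis using that by blast
  qed
  obtain R where R: "bounded_clinear R" "\<And>x y. R (t x y) = t x (B y)"
  proof -
    obtain K Q where K: "0 \<le> K"
      "\<And>x y. of_real (K\<^sup>2) * cinner x y = cinner (B x) (B y) + cinner (Q x) (Q y :: 'b)"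
      using contraction_defect[OF B] by blast
    have "of_real (K\<^sup>2) * (cinner x x' * cinner y y')
        = cinner (t x (B y)) (t x' (B y')) + cinner (t x (Q y)) (t x' (Q y'))" for x y x' y'
      unfolding cinner_t distrib_left[symmetric] K(2)[symmetric] by (rule mult.left_commute)
    from hilbert_tensor_extension[OF t K(1) this] show ?thesis using that by blast
  qed
  show ?thesis
  proof (rule ex1I)
    show "bounded_clinear (L \<circ> R) \<and> (\<forall>x y. (L \<circ> R) (t x y) = t (A x) (B y))"
      by (simp add: bounded_clinear_compose L R)
    then show "W = L \<circ> R" if "bounded_clinear W \<and> (\<forall>x y. W (t x y) = t (A x) (B y))" for W
      using that by (intro hilbert_tensor_ext[OF t]) auto
  qed
qed

lemma bounded_clinear_tensor_op:
    "hilbert_tensor t \<Longrightarrow> bounded_clinear A \<Longrightarrow> bounded_clinear B \<Longrightarrow> bounded_clinear (tensor_op t A B)"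
  and tensor_op_apply:
    "hilbert_tensor t \<Longrightarrow> bounded_clinear A \<Longrightarrow> bounded_clinear B
      \<Longrightarrow> tensor_op t A B (t x y) = t (A x) (B y)"
  using theI'[OF tensor_op_ex1] unfolding tensor_op_def by blast+

lemma tensor_op_eqI:
  "hilbert_tensor t \<Longrightarrow> bounded_clinear A \<Longrightarrow> bounded_clinear B \<Longrightarrow> bounded_clinear W
    \<Longrightarrow> (\<And>x y. W (t x y) = t (A x) (B y)) \<Longrightarrow> tensor_op t A B = W"
  unfolding tensor_op_def by (rule the1_equality[OF tensor_op_ex1]) auto

text \<open>The families \<open>t x y\<close> and \<open>u y x\<close> have the same Gram matrix, so
  both assignments extend with constant 1 and zero remainder, and density makes them mutually
  inverse.\<close>

lemma tensor_swap:
  fixes t :: "'a::chilbert_space \<Rightarrow> 'b::chilbert_space \<Rightarrow> 'c::chilbert_space"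
    and u :: "'b \<Rightarrow> 'a \<Rightarrow> 'd::chilbert_space"
  assumes t: "hilbert_tensor t" and u: "hilbert_tensor u"
  obtains W W' where "hilbert_isomorphism W W'" "\<And>x y. W (t x y) = u y x" "\<And>x y. W' (u y x) = t x y"
proof -
  have cinner_t: "cinner (t x y) (t x' y') = cinner x x' * cinner y y'" for x y x' y'
    using t by (simp add: hilbert_tensor_def)
  have cinner_u: "cinner (u y x) (u y' x') = cinner y y' * cinner x x'" for x y x' y'
    using u by (simp add: hilbert_tensor_def)
  obtain W where W: "bounded_clinear W" "\<And>x y. W (t x y) = u y x"
    by (rule hilbert_tensor_extension[OF t, of 1 "\<lambda>x y. u y x" "\<lambda>x y. 0 :: complex"])
      (auto simp: cinner_u)
  obtain W' where W': "bounded_clinear W'" "\<And>y x. W' (u y x) = t x y"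
    by (rule hilbert_tensor_extension[OF u, of 1 "\<lambda>y x. t x y" "\<lambda>x y. 0 :: complex"])
      (auto simp: cinner_t)
  have cont: "continuous_on UNIV (\<lambda>z. cinner (A z) w)" "continuous_on UNIV (\<lambda>z. cinner w (A z))"
    if "bounded_clinear A" for A :: "'x::complex_inner \<Rightarrow> 'y::complex_inner" and w
    using bounded_bilinear.continuous_on[OF bounded_bilinear_cinner]
      bounded_clinear_continuous[OF that] continuous_on_const by blast+
  \<comment> \<open>Isometry is propagated by density one argument at a time, first against an
    elementary tensor.\<close>
  have cinner_W_elem: "cinner (W z) (W (t x y)) = cinner z (t x y)" for z x y
    by (rule hilbert_tensor_induct[OF t, where P = "\<lambda>z. cinner (W z) (W (t x y)) = cinner z (t x y)"])
      (auto simp: W(2) cinner_t cinner_u cinner_simps bounded_clinear_simps[OF W(1)]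
        intro!: closed_Collect_eq cont[OF W(1)] cont[OF bounded_clinear_id, unfolded id_apply])
  have cinner_W: "cinner (W z) (W w) = cinner z w" for z w
    by (rule hilbert_tensor_induct[OF t, where P = "\<lambda>w. cinner (W z) (W w) = cinner z w"])
      (auto simp: cinner_W_elem cinner_simps bounded_clinear_simps[OF W(1)]
        intro!: closed_Collect_eq cont[OF W(1)] cont[OF bounded_clinear_id, unfolded id_apply])
  have inv: "W' \<circ> W = id" "W \<circ> W' = id"
    by (rule hilbert_tensor_ext[OF t] hilbert_tensor_ext[OF u];
        simp add: W W' bounded_clinear_compose bounded_clinear_id)+
  have "hilbert_isomorphism W W'"
  proof
    show "W' (W x) = x" "W (W' y) = y" for x y
      using inv by (metis comp_apply id_apply)+
  qed (fact W(1) W'(1) cinner_W)+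
  then show ?thesis using that W(2) W'(2) by blast
qed

theorem lemma10:
  fixes S :: "'a::chilbert_space \<Rightarrow> 'a"
    and T :: "'b::chilbert_space \<Rightarrow> 'b"
    and l :: real
  assumes "bounded_clinear S"
    and "bounded_clinear T"
    and "0 \<le> l" and "l \<le> 1"
  shows "(\<forall>c :: complex. mean_transform l (\<lambda>x. c *\<^sub>C S x) = (\<lambda>x. c *\<^sub>C mean_transform l S x)) \<and>
    (\<forall>U :: 'a \<Rightarrow> 'a. unitary_op U \<longrightarrow>
      mean_transform l (U \<circ> S \<circ> cadjoint U) = U \<circ> mean_transform l S \<circ> cadjoint U) \<and>
    (\<forall>(t12 :: 'a \<Rightarrow> 'b \<Rightarrow> 'c::chilbert_space) (t21 :: 'b \<Rightarrow> 'a \<Rightarrow> 'd::chilbert_space).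
      hilbert_tensor t12 \<and> hilbert_tensor t21 \<longrightarrow>
        spectral_radius (mean_transform l (tensor_op t21 T S)) =
          spectral_radius (mean_transform l (tensor_op t12 S T)) \<and>
        numerical_radius (mean_transform l (tensor_op t21 T S)) =
          numerical_radius (mean_transform l (tensor_op t12 S T)) \<and>
        onorm (mean_transform l (tensor_op t21 T S)) =
          onorm (mean_transform l (tensor_op t12 S T)))"
proof (intro conjI[OF _ conjI] allI impI)
  show "mean_transform l (\<lambda>x. c *\<^sub>C S x) = (\<lambda>x. c *\<^sub>C mean_transform l S x)" for c
    by (rule mean_transform_scaleC[OF assms(1)])
  show "mean_transform l (U \<circ> S \<circ> cadjoint U) = U \<circ> mean_transform l S \<circ> cadjoint U"
    if "unitary_op U" for U
    by (rule hilbert_isomorphism.mean_transform_conj[OF hilbert_isomorphism_unitary[OF that] assms(1)])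
next
  fix t12 :: "'a \<Rightarrow> 'b \<Rightarrow> 'c" and t21 :: "'b \<Rightarrow> 'a \<Rightarrow> 'd"
  assume t: "hilbert_tensor t12 \<and> hilbert_tensor t21"
  then obtain W W' where "hilbert_isomorphism W W'"
    and swap: "\<And>x y. W (t12 x y) = t21 y x" "\<And>x y. W' (t21 y x) = t12 x y"
    using tensor_swap by metis
  then interpret hilbert_isomorphism W W' by simp
  note ST = bounded_clinear_tensor_op[OF conjunct1[OF t] assms(1,2)]
  \<comment> \<open>On \<open>t21 y x\<close> the conjugated operator passes through
    \<open>t12 x y\<close> and \<open>t12 (S x) (T y)\<close> to \<open>t21 (T y) (S x)\<close>;
    uniqueness of the tensor operator identifies it.\<close>
  have "tensor_op t21 T S = W \<circ> tensor_op t12 S T \<circ> W'"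
    using t assms(1,2) by (intro tensor_op_eqI bounded_clinear_conj ST) (auto simp: swap tensor_op_apply)
  then have mean: "mean_transform l (tensor_op t21 T S) = W \<circ> mean_transform l (tensor_op t12 S T) \<circ> W'"
    by (simp add: mean_transform_conj[OF ST])
  show "spectral_radius (mean_transform l (tensor_op t21 T S)) =
      spectral_radius (mean_transform l (tensor_op t12 S T))"
    unfolding mean by (rule spectral_radius_conj)
  show "numerical_radius (mean_transform l (tensor_op t21 T S)) =
      numerical_radius (mean_transform l (tensor_op t12 S T))"
    unfolding mean by (rule numerical_radius_conj)
  show "onorm (mean_transform l (tensor_op t21 T S)) = onorm (mean_transform l (tensor_op t12 S T))"
    unfolding mean by (rule onorm_conj)
qed

end
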